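(* Let $d\in\mathbb{N}$, $d\ge 1$, and let $F\subset\mathbb{R}^d$ be a nonempty compact set. Then \[ \dim_{\mathrm{L}} F=\min_{E\in\mathcal{G}_F} \dim_{\mathrm{H}} E=\min_{E\in\mathcal{G}_F} \overline{\dim}_{\mathrm{B}}\, E . \] In particular, both minima exist (are attained by elements of the gallery $\mathcal{G}_F$).
   Context: Dimensions. $\dim_{\mathrm{H}}$ denotes Hausdorff dimension and $\overline{\dim}_{\mathrm{B}}$ upper box dimension. For a bounded set $A\subset\mathbb{R}^d$ and $r>0$, $N_r(A)$ is the smallest number of cubes of side length $r$ needed to cover $A$. $B(x,R)$ is the closed ball of centre $x$ and radius $R$. The lower dimension is \[ \dim_{\mathrm{L}} F=\sup\Big\{s\ge 0: \exists C>0\ \forall\, 0<R<1\ \forall\, r\in(0,R)\ \forall x\in F:\ N_r(B(x,R)\cap F)\ge C\big(\tfrac{R}{r}\big)^s\Big\}. \] Microsets and galleries. Let $X=[0,1]^d$ and let $\mathcal{K}(X)$ be the space of nonempty compact subsets of $X$ with the Hausdorff metric $d_{\mathcal{H}}$. A set $D\in\mathcal{K}(X)$ is a miniset of a compact set $F\subset\mathbb{R}^d$ if $D=(\lambda F+t)\cap X$ for some $\lambda\ge 1$ and $t\in\mathbb{R}^d$. A set $E\in\mathcal{K}(X)$ is a microset of $F$ if it is a limit, in the Hausdorff metric, of a sequence of minisets of $F$ (the scaling coefficients $\lambda$ are not required to be unbounded along the sequence). The gallery $\mathcal{G}_F$ is the collection of all microsets of $F$ which intersect the interior $(0,1)^d$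 of $X$. *)

theory Defs
  imports "HOL-Analysis.Analysis"
begin

text \<open>All dimensions take values in \<^typ>\<open>ereal\<close>, so that suprema and infima of
  unbounded or empty sets have their conventional values.\<close>

subsection \<open>Hausdorff dimension\<close>

text \<open>The summand \<open>|U|\<^sup>s\<close>, with the convention that \<open>|U|\<^sup>0 = 1\<close> for nonempty \<open>U\<close>
  (whereas \<open>0 powr 0 = 0\<close> in the library).\<close>

definition diam_powr :: "real \<Rightarrow> 'a::metric_space set \<Rightarrow> ennreal" where
  "diam_powr s U = (if U = {} then 0 else if s = 0 then 1 else ennreal (diameter U powr s))"

text \<open>\<^const>\<open>diameter\<close> is real-valued and meaningless on unbounded sets, hence the explicit
  boundedness of the covering sets. Finite covers are included by padding with \<open>{}\<close>.\<close>

definition hausdorff_premeasure :: "real \<Rightarrow> real \<Rightarrow> 'a::metric_space set \<Rightarrow> ennreal" where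
  "hausdorff_premeasure s \<delta> E =
     (INF U \<in> {U :: nat \<Rightarrow> 'a set. E \<subseteq> (\<Union>i. U i) \<and> (\<forall>i. bounded (U i) \<and> diameter (U i) \<le> \<delta>)}.
        \<Sum>i. diam_powr s (U i))"

definition hausdorff_measure :: "real \<Rightarrow> 'a::metric_space set \<Rightarrow> ennreal" where
  "hausdorff_measure s E = (SUP \<delta> \<in> {0<..}. hausdorff_premeasure s \<delta> E)"

definition hausdorff_dim :: "'a::metric_space set \<Rightarrow> ereal" where
  "hausdorff_dim E = (INF s \<in> {s. 0 \<le> s \<and> hausdorff_measure s E = 0}. ereal s)"

subsection \<open>Covering numbers, upper box dimension, lower dimension\<close>

text \<open>The cubes are closed and axis-parallel; \<open>P\<close> is the set of their lower corners. The
  \<open>LEAST\<close> is meaningful for bounded \<open>A\<close> and \<open>r > 0\<close>, the only case in which it is used.\<close>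

definition covering_number :: "real \<Rightarrow> 'a::euclidean_space set \<Rightarrow> nat" where
  "covering_number r A =
     (LEAST n. \<exists>P. finite P \<and> card P = n \<and> A \<subseteq> (\<Union>a\<in>P. cbox a (a + r *\<^sub>R One)))"

definition upper_box_dim :: "'a::euclidean_space set \<Rightarrow> ereal" where
  "upper_box_dim E =
     Limsup (at_right 0) (\<lambda>r::real. ereal (ln (real (covering_number r E)) / (- ln r)))"

definition lower_dim :: "'a::euclidean_space set \<Rightarrow> ereal" where
  "lower_dim F =
     (SUP s \<in> {s::real. 0 \<le> s \<and>
        (\<exists>C>0. \<forall>R. 0 < R \<and> R < 1 \<longrightarrow> (\<forall>r. 0 < r \<and> r < R \<longrightarrow> (\<forall>x\<in>F.
           real (covering_number r (cball x R \<inter> F)) \<ge> C * (R / r) powr s)))}. ereal s)"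

subsection \<open>Microsets and galleries\<close>

definition unit_cube :: "'a::euclidean_space set" where
  "unit_cube = cbox 0 One"

definition compacts_of_cube :: "'a::euclidean_space set set" where
  "compacts_of_cube = {K. compact K \<and> K \<noteq> {} \<and> K \<subseteq> unit_cube}"

definition hausdorff_dist :: "'a::metric_space set \<Rightarrow> 'a set \<Rightarrow> real" where
  "hausdorff_dist A B = max (SUP a\<in>A. infdist a B) (SUP b\<in>B. infdist b A)"

definition miniset :: "'a::euclidean_space set \<Rightarrow> 'a set \<Rightarrow> bool" where
  "miniset F D \<longleftrightarrow> D \<in> compacts_of_cube \<and>
     (\<exists>c t. (1::real) \<le> c \<and> D = (\<lambda>x. c *\<^sub>R x + t) ` F \<inter> unit_cube)"

definition microset :: "'a::euclidean_space set \<Rightarrow> 'a set \<Rightarrow> bool" where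
  "microset F E \<longleftrightarrow> E \<in> compacts_of_cube \<and>
     (\<exists>D :: nat \<Rightarrow> 'a set. (\<forall>n. miniset F (D n)) \<and> (\<lambda>n. hausdorff_dist (D n) E) \<longlonglongrightarrow> 0)"

definition gallery :: "'a::euclidean_space set \<Rightarrow> 'a set set" where
  "gallery F = {E. microset F E \<and> E \<inter> interior unit_cube \<noteq> {}}"

end

theory Submission
  imports Defs "HOL-Complex_Analysis.Great_Picard"
begin

text \<open>
  Everything reduces to counting \<open>\<delta>\<close>-spaced finite sets, which are comparable to covering numbers
  (\<open>covering_number_le_spaced\<close>), scale correctly under similarities and pass to limits in the Hausdorff
  metric (\<open>spaced_transfer\<close>). The theorem follows from three inequalities.

  Every member \<open>E\<close> of the gallery satisfies \<open>lower_dim F \<le> hausdorff_dim E\<close>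
  (\<open>lower_dim_le_hausdorff_dim_gallery\<close>). If the covering numbers of \<open>F\<close> in
  balls of radius \<open>R < 1\<close> are at least \<open>C (R/r)\<^sup>s\<close>, then \<open>F\<close> has comparably many points of spacing \<open>r\<close>
  in these balls. So do all its magnifications, with the same constants, and hence, with slightly
  worse ones, so does \<open>E\<close> in balls inside the unit cube. For \<open>\<sigma> < s\<close> and a small ratio \<open>\<rho>\<close>, every such ball
  therefore contains at least \<open>\<rho>\<^sup>-\<^sup>\<sigma>\<close> separated balls of relative radius \<open>\<rho>\<close>. Iterating, one sees a Cantor set
  of dimension at least \<open>\<sigma>\<close>; the lemma \<open>finite_cover_sum_ge\<close> extracts the positivity of the
  \<open>\<sigma>\<close>-dimensional measure by a direct induction on the size of a cover.

  Some member \<open>E\<close> of the gallery satisfies \<open>upper_box_dim E \<le> lower_dim F\<close>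
  (\<open>gallery_upper_box_dim_le_lower_dim\<close>). The same induction applied to \<open>F\<close> shows that, for every \<open>s\<close>
  above the lower dimension and every \<open>m\<close>, there is a ball \<open>cball x R\<close> with few points of spacing
  of order \<open>2\<^sup>-\<^sup>k R\<close> for all \<open>k \<le> m\<close> at once: otherwise the branching could be iterated and \<open>s\<close> would be an
  admissible exponent. Magnifying such balls, with \<open>s\<close> decreasing to the lower dimension and \<open>m\<close>
  increasing, gives minisets centred at a point of \<open>F\<close>. By Blaschke's selection theorem a subsequence
  converges; its limit contains the centre of the cube and has few spaced points at every scale.

  Finally \<open>hausdorff_dim E \<le> upper_box_dim E\<close> holds for every nonempty bounded set, so the same \<open>E\<close>
  minimises both dimensions over the gallery.
\<close>

section \<open>Spaced sets and covering numbers\<close>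

abbreviation spaced :: "real \<Rightarrow> 'a::metric_space set \<Rightarrow> bool" where
  "spaced \<delta> \<equiv> pairwise (\<lambda>x y. \<delta> \<le> dist x y)"

lemma spaced_mono: "spaced \<delta> T \<Longrightarrow> \<delta>' \<le> \<delta> \<Longrightarrow> spaced \<delta>' T"
  by (auto simp: pairwise_def) (meson order_trans)

text \<open>A spaced subset of largest possible cardinality is a net. Total boundedness bounds the
  cardinalities: a ball of radius \<open>\<delta> / 2\<close> contains at most one point of a \<open>\<delta>\<close>-spaced set.\<close>

lemma maximal_spaced_subset:
  fixes A :: "'a::heine_borel set"
  assumes "bounded A" "0 < \<delta>"
  obtains T where "finite T" "T \<subseteq> A" "spaced \<delta> T" "A \<subseteq> (\<Union>t\<in>T. ball t \<delta>)"
proof -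
  have "seq_compact (closure A)"
    using assms by (simp add: bounded_closure compact_closure compact_imp_seq_compact)
  then obtain K where K: "finite K" "closure A \<subseteq> (\<Union>k\<in>K. ball k (\<delta>/2))"
    using seq_compact_imp_totally_bounded[of "closure A", rule_format, of "\<delta>/2"] assms by auto
  have "A \<subseteq> (\<Union>k\<in>K. ball k (\<delta>/2))" using K(2) closure_subset by blast
  define \<T> where "\<T> T \<longleftrightarrow> finite T \<and> T \<subseteq> A \<and> spaced \<delta> T" for T
  have "card T \<le> card K" if T: "\<T> T" for T
  proof -
    have "\<exists>k. k \<in> K \<and> dist k t < \<delta>/2" if "t \<in> T" for t
    proof -
      have "t \<in> (\<Union>k\<in>K. ball k (\<delta>/2))"
        using T \<open>A \<subseteq> _\<close> that unfolding \<T>_def by (meson subsetD)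
      then show ?thesis by auto
    qed
    then obtain f where f: "\<And>t. t \<in> T \<Longrightarrow> f t \<in> K" "\<And>t. t \<in> T \<Longrightarrow> dist (f t) t < \<delta>/2" by metis
    have "inj_on f T"
    proof (rule inj_onI, rule ccontr)
      fix t u assume tu: "t \<in> T" "u \<in> T" "f t = f u" "t \<noteq> u"
      have "dist t u \<le> dist (f t) t + dist (f u) u" using tu(3) by metric
      also have "\<dots> < \<delta>" using f(2)[OF tu(1)] f(2)[OF tu(2)] by simp
      finally show False using T tu unfolding \<T>_def pairwise_def by force
    qed
    then show ?thesis using f K by (intro card_inj_on_le[of f]) auto
  qed
  moreover have "\<T> {}" by (simp add: \<T>_def)
  ultimately obtain T where T: "\<T> T" "\<And>T'. \<T> T' \<Longrightarrow> card T' \<le> card T"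
    using ex_has_greatest_nat[of \<T> "{}" card "Suc (card K)"] by (auto simp: less_Suc_eq_le)
  have "A \<subseteq> (\<Union>t\<in>T. ball t \<delta>)"
  proof
    fix a assume "a \<in> A"
    show "a \<in> (\<Union>t\<in>T. ball t \<delta>)"
    proof (rule ccontr)
      assume "a \<notin> (\<Union>t\<in>T. ball t \<delta>)"
      then have far: "\<delta> \<le> dist t a" if "t \<in> T" for t using that by force
      then have "a \<notin> T" using assms by force
      have "\<T> (insert a T)"
        using T(1) far \<open>a \<in> A\<close> unfolding \<T>_def by (auto simp: pairwise_insert dist_commute)
      from T(2)[OF this] show False using T(1) \<open>a \<notin> T\<close> by (simp add: \<T>_def)
    qed
  qed
  then show thesis using that T(1) unfolding \<T>_def by blast
qed

lemma ball_subset_cube: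
  fixes t :: "'a::euclidean_space"
  shows "ball t h \<subseteq> cbox (t - h *\<^sub>R One) (t - h *\<^sub>R One + (2 * h) *\<^sub>R One)"
proof
  fix y assume y: "y \<in> ball t h"
  show "y \<in> cbox (t - h *\<^sub>R One) (t - h *\<^sub>R One + (2 * h) *\<^sub>R One)"
    unfolding mem_box
  proof
    fix b :: 'a assume b: "b \<in> Basis"
    have "\<bar>(y - t) \<bullet> b\<bar> < h"
      using Basis_le_norm[OF b, of "y - t"] y by (simp add: dist_norm norm_minus_commute)
    then have "\<bar>y \<bullet> b - t \<bullet> b\<bar> < h" by (simp add: inner_diff_left)
    then show "(t - h *\<^sub>R One) \<bullet> b \<le> y \<bullet> b \<and> y \<bullet> b \<le> (t - h *\<^sub>R One + (2 * h) *\<^sub>R One) \<bullet> b"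
      using b by (simp add: inner_diff_left inner_add_left abs_less_iff)
  qed
qed

lemma spaced_cube_cover:
  fixes A :: "'a::euclidean_space set"
  assumes "bounded A" "0 < r"
  obtains T where "finite T" "T \<subseteq> A" "spaced (r/2) T"
    "A \<subseteq> (\<Union>a\<in>(\<lambda>t. t - (r/2) *\<^sub>R One) ` T. cbox a (a + r *\<^sub>R One))"
proof -
  obtain T where T: "finite T" "T \<subseteq> A" "spaced (r/2) T" "A \<subseteq> (\<Union>t\<in>T. ball t (r/2))"
    using maximal_spaced_subset[OF assms(1), of "r/2"] assms(2) by auto
  moreover have "A \<subseteq> (\<Union>a\<in>(\<lambda>t. t - (r/2) *\<^sub>R One) ` T. cbox a (a + r *\<^sub>R One))"
    using T(4) ball_subset_cube[of _ "r/2"] by fastforce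
  ultimately show thesis using that by blast
qed

text \<open>Large covering numbers thus yield large spaced sets, the form in which the lower dimension
  of \<open>F\<close> is passed on to its microsets.\<close>

lemma covering_number_le_spaced:
  fixes A :: "'a::euclidean_space set"
  assumes "bounded A" "0 < r"
  obtains T where "finite T" "T \<subseteq> A" "spaced (r/2) T" "covering_number r A \<le> card T"
proof -
  obtain T where T: "finite T" "T \<subseteq> A" "spaced (r/2) T"
    "A \<subseteq> (\<Union>a\<in>(\<lambda>t. t - (r/2) *\<^sub>R One) ` T. cbox a (a + r *\<^sub>R One))"
    by (rule spaced_cube_cover[OF assms])
  define P where "P = (\<lambda>t. t - (r/2) *\<^sub>R One) ` T"
  have "covering_number r A \<le> card P"
    unfolding covering_number_def using T(1,4) unfolding P_def[symmetric]
    by (intro Least_le exI[of _ P]) (simp add: P_def)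
  also have "\<dots> \<le> card T" unfolding P_def by (rule card_image_le) fact
  finally show thesis using that T(1-3) by blast
qed

text \<open>Some finite cover exists, so the \<open>LEAST\<close> in the definition is a genuine minimum.\<close>

lemma covering_number_attained:
  fixes A :: "'a::euclidean_space set"
  assumes "bounded A" "0 < r"
  obtains P where "finite P" "card P = covering_number r A" "A \<subseteq> (\<Union>a\<in>P. cbox a (a + r *\<^sub>R One))"
proof -
  obtain T where T: "finite T"
    "A \<subseteq> (\<Union>a\<in>(\<lambda>t. t - (r/2) *\<^sub>R One) ` T. cbox a (a + r *\<^sub>R One))"
    by (rule spaced_cube_cover[OF assms])
  have "finite ((\<lambda>t. t - (r/2) *\<^sub>R One) ` T)" using T(1) by (rule finite_imageI)
  then have "\<exists>n. \<exists>P. finite P \<and> card P = n \<and> A \<subseteq> (\<Union>a\<in>P. cbox a (a + r *\<^sub>R One))"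
    using T(2) by metis
  from LeastI_ex[OF this] show thesis using that unfolding covering_number_def by blast
qed

lemma covering_number_pos:
  fixes A :: "'a::euclidean_space set"
  assumes "bounded A" "0 < r" "A \<noteq> {}"
  shows "1 \<le> covering_number r A"
proof -
  obtain P where P: "finite P" "card P = covering_number r A" "A \<subseteq> (\<Union>a\<in>P. cbox a (a + r *\<^sub>R One))"
    using covering_number_attained[OF assms(1,2)] by blast
  then have "P \<noteq> {}" using assms by auto
  then have "0 < card P" using P(1) by (simp add: card_gt_0_iff)
  then show ?thesis using P(2) by simp
qed

lemma diameter_cube_le:
  fixes a :: "'a::euclidean_space"
  assumes "0 \<le> r"
  shows "diameter (cbox a (a + r *\<^sub>R One)) \<le> r * real DIM('a)"
proof -
  have "norm (One :: 'a) \<le> (\<Sum>b\<in>Basis. \<bar>(One :: 'a) \<bullet> b\<bar>)" by (rule norm_le_l1)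
  also have "\<dots> = real DIM('a)" by simp
  finally have "r * norm (One :: 'a) \<le> r * real DIM('a)" using assms by (rule mult_left_mono)
  moreover have "diameter (cbox a (a + r *\<^sub>R One)) = dist a (a + r *\<^sub>R One)"
    using assms by (intro diameter_cbox) (simp add: inner_add_left)
  ultimately show ?thesis using assms by (simp add: dist_norm)
qed

lemma spaced_affine_image:
  fixes T :: "'a::real_normed_vector set"
  assumes "0 < c" "spaced \<delta> T"
  shows "spaced (c * \<delta>) ((\<lambda>x. c *\<^sub>R x + t) ` T)" "card ((\<lambda>x. c *\<^sub>R x + t) ` T) = card T"
proof -
  have d: "dist (c *\<^sub>R x + t) (c *\<^sub>R y + t) = c * dist x y" for x y
    using \<open>0 < c\<close> by (simp add: dist_norm flip: scaleR_diff_right)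
  show "spaced (c * \<delta>) ((\<lambda>x. c *\<^sub>R x + t) ` T)"
    using assms unfolding pairwise_image by (auto simp: pairwise_def d simp del: dist_add_cancel2)
  have "inj_on (\<lambda>x. c *\<^sub>R x + t) T" using \<open>0 < c\<close> by (auto intro!: inj_onI)
  then show "card ((\<lambda>x. c *\<^sub>R x + t) ` T) = card T" by (rule card_image)
qed

section \<open>The Hausdorff metric on compact sets\<close>

lemma hausdorff_dist_commute: "hausdorff_dist A B = hausdorff_dist B A"
  by (simp add: hausdorff_dist_def max.commute)

lemma infdist_le_hausdorff_dist:
  assumes "compact A" "a \<in> A"
  shows "infdist a B \<le> hausdorff_dist A B"
proof -
  have "compact ((\<lambda>a. infdist a B) ` A)"
    using assms by (intro compact_continuous_image continuous_intros)
  then have "bdd_above ((\<lambda>a. infdist a B) ` A)"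
    by (intro bounded_imp_bdd_above compact_imp_bounded)
  then have "infdist a B \<le> (SUP a\<in>A. infdist a B)" using assms by (intro cSUP_upper)
  then show ?thesis unfolding hausdorff_dist_def by simp
qed

lemma hausdorff_dist_le:
  assumes "A \<noteq> {}" "B \<noteq> {}" "\<And>a. a \<in> A \<Longrightarrow> infdist a B \<le> e" "\<And>b. b \<in> B \<Longrightarrow> infdist b A \<le> e"
  shows "hausdorff_dist A B \<le> e"
  using assms unfolding hausdorff_dist_def by (auto intro!: cSUP_least)

lemma hausdorff_dist_nonneg:
  assumes "compact A" "A \<noteq> {}"
  shows "0 \<le> hausdorff_dist A B"
  using assms infdist_le_hausdorff_dist infdist_nonneg by (metis all_not_in_conv order_trans)

lemma hausdorff_dist_less_imp_near:
  fixes A B :: "'a::heine_borel set"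
  assumes "compact A" "compact B" "B \<noteq> {}" "hausdorff_dist A B < e" "a \<in> A"
  obtains b where "b \<in> B" "dist a b < e"
proof -
  obtain b where "b \<in> B" "infdist a B = dist a b"
    using infdist_attains_inf[of B a] assms compact_imp_closed by blast
  then show ?thesis using that infdist_le_hausdorff_dist[OF assms(1,5), of B] assms(4) by auto
qed

text \<open>Spaced sets are the right substitute for covers when passing to Hausdorff limits: moving every
  point of a spaced set slightly costs only a little of the spacing and none of the points.\<close>

lemma spaced_transfer:
  fixes A B :: "'a::heine_borel set"
  assumes "compact A" "compact B" "B \<noteq> {}" "hausdorff_dist A B < e"
    and T: "finite T" "T \<subseteq> A" "spaced \<delta> T" and "2 * e < \<delta>"
  obtains T' where "finite T'" "T' \<subseteq> B" "card T' = card T" "spaced (\<delta> - 2 * e) T'"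
    "\<And>t'. t' \<in> T' \<Longrightarrow> \<exists>t\<in>T. dist t t' < e"
proof -
  have "\<exists>b. b \<in> B \<and> dist t b < e" if "t \<in> T" for t
    using hausdorff_dist_less_imp_near[OF assms(1-4)] T that by blast
  then obtain f where f: "\<And>t. t \<in> T \<Longrightarrow> f t \<in> B" "\<And>t. t \<in> T \<Longrightarrow> dist t (f t) < e" by metis
  have d: "\<delta> - 2 * e \<le> dist (f t) (f u)" if "t \<in> T" "u \<in> T" "t \<noteq> u" for t u
  proof -
    have "\<delta> \<le> dist t u" using T that by (auto simp: pairwise_def)
    also have "\<dots> \<le> dist t (f t) + dist (f t) (f u) + dist u (f u)" by metric
    finally show ?thesis using f(2)[OF that(1)] f(2)[OF that(2)] by simp
  qed
  have "inj_on f T"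
  proof (rule inj_onI, rule ccontr)
    fix t u assume "t \<in> T" "u \<in> T" "f t = f u" "t \<noteq> u"
    then show False using d[of t u] \<open>2 * e < \<delta>\<close> by simp
  qed
  show thesis
  proof
    show "finite (f ` T)" "f ` T \<subseteq> B" using T f by auto
    show "card (f ` T) = card T" using \<open>inj_on f T\<close> by (rule card_image)
    show "spaced (\<delta> - 2 * e) (f ` T)" using d by (auto simp: pairwise_def)
    show "\<exists>t\<in>T. dist t t' < e" if "t' \<in> f ` T" for t' using f that by auto
  qed
qed

text \<open>Compact subsets are encoded by their distance functions. These are equi-Lipschitz and bounded
  on \<open>X\<close>, so the Arzela-Ascoli theorem yields a uniformly convergent subsequence, and uniform
  convergence of distance functions is convergence in the Hausdorff metric.\<close>

lemma Blaschke_selection: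
  fixes D :: "nat \<Rightarrow> 'a::euclidean_space set"
  assumes "compact X" and D: "\<And>n. compact (D n)" "\<And>n. D n \<noteq> {}" "\<And>n. D n \<subseteq> X"
  obtains E k where "strict_mono (k :: nat \<Rightarrow> nat)" "compact E" "E \<noteq> {}" "E \<subseteq> X"
    "(\<lambda>n. hausdorff_dist (D (k n)) E) \<longlonglongrightarrow> 0"
proof -
  have lip: "\<bar>infdist x A - infdist y A\<bar> \<le> dist x y" for x y and A :: "'a set"
    by (rule infdist_triangle_abs)
  have bound: "norm (infdist x (D n)) \<le> diameter X" if "x \<in> X" for x n
  proof -
    obtain d where "d \<in> D n" using D by blast
    then have "infdist x (D n) \<le> dist x d" by (rule infdist_le)
    also have "\<dots> \<le> diameter X"
      using that \<open>d \<in> D n\<close> D \<open>compact X\<close> by (intro diameter_bounded_bound compact_imp_bounded) auto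
    finally show ?thesis by (simp add: infdist_nonneg)
  qed
  have equi: "\<exists>d. 0 < d \<and> (\<forall>n y. y \<in> X \<and> norm (x - y) < d \<longrightarrow> norm (infdist x (D n) - infdist y (D n)) < e)"
    if "x \<in> X" "0 < e" for x and e :: real
  proof (intro exI[of _ e] conjI allI impI)
    fix n y assume "y \<in> X \<and> norm (x - y) < e"
    then show "norm (infdist x (D n) - infdist y (D n)) < e"
      using lip[of x "D n" y] by (simp add: dist_norm)
  qed fact
  obtain g k where "continuous_on X g" and k: "strict_mono (k :: nat \<Rightarrow> nat)"
    and unif: "\<And>e. 0 < e \<Longrightarrow> \<exists>N. \<forall>n x. n \<ge> N \<and> x \<in> X \<longrightarrow> norm (infdist x (D (k n)) - g x) < e"
  proof (rule Arzela_Ascoli[of X "\<lambda>n x. infdist x (D n)" "diameter X", OF \<open>compact X\<close> bound equi])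
    fix g and k :: "nat \<Rightarrow> nat"
    assume "continuous_on X g" "strict_mono k"
      and "\<And>e. 0 < e \<Longrightarrow> \<exists>N. \<forall>n x. n \<ge> N \<and> x \<in> X \<longrightarrow> norm (infdist x (D (k n)) - g x) < e"
    then show thesis by (rule that)
  qed
  have lim: "(\<lambda>n. infdist x (D (k n))) \<longlonglongrightarrow> g x" if "x \<in> X" for x
    unfolding LIMSEQ_def dist_norm using unif that by blast
  have g_lip: "g x \<le> g y + dist x y" if "x \<in> X" "y \<in> X" for x y
  proof (rule LIMSEQ_le)
    show "(\<lambda>n. infdist x (D (k n))) \<longlonglongrightarrow> g x" using lim that by blast
    show "(\<lambda>n. infdist y (D (k n)) + dist x y) \<longlonglongrightarrow> g y + dist x y"
      using lim that by (intro tendsto_intros)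
    show "\<exists>N. \<forall>n\<ge>N. infdist x (D (k n)) \<le> infdist y (D (k n)) + dist x y"
      by (simp add: infdist_triangle)
  qed
  \<comment> \<open>The limit \<open>g\<close> turns out to be the distance function of its own zero set.\<close>
  define E where "E = {x \<in> X. g x = 0}"
  have E_near: "\<exists>z\<in>E. dist x z = g x" if x: "x \<in> X" for x
  proof -
    \<comment> \<open>A cluster point \<open>l\<close> of the points of \<open>D (k n)\<close> nearest to \<open>x\<close> is a zero of \<open>g\<close> at
      distance \<open>g x\<close> from \<open>x\<close>.\<close>
    have "\<exists>z. z \<in> D (k n) \<and> infdist x (D (k n)) = dist x z" for n
      using infdist_attains_inf[OF compact_imp_closed[OF D(1)] D(2), of "k n" x] by metis
    then obtain z where z: "\<And>n. z n \<in> D (k n)" "\<And>n. infdist x (D (k n)) = dist x (z n)" by metis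
    have "\<forall>n. z n \<in> X" using z D by blast
    then obtain l r where l: "l \<in> X" "strict_mono r" "(z \<circ> r) \<longlonglongrightarrow> l"
      using \<open>compact X\<close> unfolding compact_def by blast
    have "(\<lambda>n. dist x (z (r n))) \<longlonglongrightarrow> dist x l"
      using l(3) by (intro tendsto_intros) (simp add: o_def)
    moreover have "(\<lambda>n. dist x (z (r n))) \<longlonglongrightarrow> g x"
      using LIMSEQ_subseq_LIMSEQ[OF lim[OF x] l(2)] by (simp add: o_def z)
    ultimately have "dist x l = g x" by (rule LIMSEQ_unique)
    have "(\<lambda>n. infdist l (D (k (r n)))) \<longlonglongrightarrow> g l"
      using LIMSEQ_subseq_LIMSEQ[OF lim[OF l(1)] l(2)] by (simp add: o_def)
    moreover have "(\<lambda>n. infdist l (D (k (r n)))) \<longlonglongrightarrow> 0"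
    proof (rule tendsto_sandwich[of "\<lambda>_. 0" _ _ "\<lambda>n. dist l (z (r n))"])
      show "\<forall>\<^sub>F n in sequentially. infdist l (D (k (r n))) \<le> dist l (z (r n))"
        using z by (simp add: infdist_le)
      have "(\<lambda>n. dist l (z (r n))) \<longlonglongrightarrow> dist l l"
        using l(3) by (intro tendsto_intros) (simp add: o_def)
      then show "(\<lambda>n. dist l (z (r n))) \<longlonglongrightarrow> 0" by simp
    qed (auto simp: infdist_nonneg)
    ultimately have "g l = 0" by (rule LIMSEQ_unique)
    then show ?thesis using l \<open>dist x l = g x\<close> unfolding E_def by blast
  qed
  have E_infdist: "infdist x E \<le> g x" if "x \<in> X" for x
    using E_near[OF that] infdist_le by metis
  have "E \<noteq> {}"
  proof -
    obtain x where "x \<in> D 0" using D by blast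
    then show ?thesis using E_near[of x] D by blast
  qed
  have "closed E"
  proof -
    have "E = X \<inter> g -` {0}" unfolding E_def by auto
    then show ?thesis
      using continuous_on_closed_vimage[of X g] \<open>continuous_on X g\<close> compact_imp_closed[OF \<open>compact X\<close>]
      by (metis closed_singleton inf_commute)
  qed
  then have "compact E"
    using \<open>compact X\<close> unfolding E_def by (metis (no_types, lifting) compact_Int_closed inf.absorb2 mem_Collect_eq subsetI)
  have "(\<lambda>n. hausdorff_dist (D (k n)) E) \<longlonglongrightarrow> 0"
  proof (rule LIMSEQ_I)
    fix e :: real assume "0 < e"
    then obtain N where N: "\<And>n x. n \<ge> N \<Longrightarrow> x \<in> X \<Longrightarrow> norm (infdist x (D (k n)) - g x) < e/2"
      using unif[of "e/2"] by auto
    have "norm (hausdorff_dist (D (k n)) E - 0) < e" if "n \<ge> N" for n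
    proof -
      have "hausdorff_dist (D (k n)) E \<le> e/2"
      proof (rule hausdorff_dist_le)
        fix a assume a: "a \<in> D (k n)"
        then have "a \<in> X" using D by blast
        then have "g a \<le> e/2" using N[OF that, of a] a by simp
        then show "infdist a E \<le> e/2" using E_infdist[OF \<open>a \<in> X\<close>] by simp
      next
        fix b assume "b \<in> E"
        then show "infdist b (D (k n)) \<le> e/2" using N[OF that, of b] by (simp add: E_def)
      qed (use D \<open>E \<noteq> {}\<close> in auto)
      moreover have "0 \<le> hausdorff_dist (D (k n)) E" using D by (intro hausdorff_dist_nonneg)
      ultimately show ?thesis using \<open>0 < e\<close> by simp
    qed
    then show "\<exists>no. \<forall>n\<ge>no. norm (hausdorff_dist (D (k n)) E - 0) < e" by blast
  qed
  then show thesis using that k \<open>compact E\<close> \<open>E \<noteq> {}\<close> unfolding E_def by blast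
qed

section \<open>Lower bounds for Hausdorff measures by branching\<close>

lemma cball_subset_cball_half:
  fixes x t :: "'a::metric_space"
  assumes "t \<in> cball x (R/2)" "\<rho> \<le> 1/2" "0 \<le> R"
  shows "cball t (\<rho> * R) \<subseteq> cball x R"
proof
  fix y assume "y \<in> cball t (\<rho> * R)"
  moreover have "\<rho> * R \<le> 1/2 * R" using assms by (intro mult_right_mono) auto
  ultimately show "y \<in> cball x R" using assms(1) dist_triangle[of x y t] by simp
qed

text \<open>A mass distribution principle without a measure. The assumption \<open>branch\<close> says that every good
  ball contains \<open>card T\<close> well separated good sub-balls of relative radius \<open>\<rho>\<close>, where
  \<open>card T * \<rho>\<^sup>s \<ge> 1\<close>; the ratio may vary from ball to ball as long as it stays above \<open>\<rho>0\<close>. Centres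
  of spacing \<open>3 \<rho> R\<close> leave gaps of width \<open>\<rho> R\<close> between the sub-balls. A
  natural measure on the resulting Cantor set would give mass at most of order \<open>|U|\<^sup>s\<close> to \<open>U\<close>. The
  same bound for finite covers follows by induction on the number of covering sets, with the
  constant \<open>\<rho>0\<^sup>s\<close> reproduced exactly at each step. It is used for Hausdorff measures of microsets and
  for covers of \<open>F\<close> itself by cubes.\<close>

lemma finite_cover_sum_ge:
  fixes A :: "'a::metric_space set" and good :: "'a \<Rightarrow> real \<Rightarrow> bool"
  assumes s: "0 < s" and \<rho>0: "0 < \<rho>0"
    and good: "\<And>x R. good x R \<Longrightarrow> x \<in> A \<and> 0 < R"
    and branch: "\<And>x R. good x R \<Longrightarrow> \<exists>\<rho> T. \<rho>0 \<le> \<rho> \<and> \<rho> \<le> 1/2 \<and> finite T \<and>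
        T \<subseteq> cball x (R/2) \<and> spaced (3 * \<rho> * R) T \<and> 1 \<le> real (card T) * \<rho> powr s \<and>
        (\<forall>t\<in>T. good t (\<rho> * R))"
    and "finite I" and "good x R" and "A \<inter> cball x R \<subseteq> (\<Union>i\<in>I. U i)"
    and "\<And>i. i \<in> I \<Longrightarrow> bounded (U i)"
  shows "(\<rho>0 * R) powr s \<le> (\<Sum>i\<in>I. diameter (U i) powr s)"
  using assms(5-8)
proof (induction I arbitrary: x R rule: finite_psubset_induct)
  case (psubset I)
  have R: "0 < R" using good psubset.prems(1) by blast
  obtain \<rho> T where \<rho>: "\<rho>0 \<le> \<rho>" "\<rho> \<le> 1/2" and fT: "finite T" and TB: "T \<subseteq> cball x (R/2)"
    and sp: "spaced (3 * \<rho> * R) T" and cT: "1 \<le> real (card T) * \<rho> powr s"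
    and gT: "\<And>t. t \<in> T \<Longrightarrow> good t (\<rho> * R)"
    using branch[OF psubset.prems(1)] by metis
  have \<rho>pos: "0 < \<rho>" using \<rho> \<rho>0 by linarith
  have sub: "cball t (\<rho> * R) \<subseteq> cball x R" if "t \<in> T" for t
    using subsetD[OF TB that] \<rho> R by (intro cball_subset_cball_half) simp_all
  \<comment> \<open>A set meeting two of the sub-balls has diameter at least \<open>\<rho> R\<close> and pays for the whole ball
    alone. Otherwise the sets are distributed over the sub-balls, each sub-ball receives a proper
    subfamily, and the induction hypothesis is added up over the sub-balls.\<close>
  have bdd: "bounded (U i)" if "i \<in> I" for i using psubset.prems(3) that by blast
  show ?case
  proof (cases "\<exists>i\<in>I. \<exists>t\<in>T. \<exists>t'\<in>T. t \<noteq> t' \<and> U i \<inter> cball t (\<rho>*R) \<noteq> {} \<and> U i \<inter> cball t' (\<rho>*R) \<noteq> {}")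
    case True
    then obtain i t t' y y' where i: "i \<in> I" "t \<in> T" "t' \<in> T" "t \<noteq> t'"
      "y \<in> U i" "y \<in> cball t (\<rho>*R)" "y' \<in> U i" "y' \<in> cball t' (\<rho>*R)" by blast
    have "3 * \<rho> * R \<le> dist t t'" using sp i by (auto simp: pairwise_def)
    also have "\<dots> \<le> dist t y + dist y y' + dist y' t'" by metric
    also have "\<dots> \<le> \<rho>*R + dist y y' + \<rho>*R" using i by (intro add_mono) (auto simp: dist_commute)
    finally have "\<rho> * R \<le> dist y y'" by (simp add: algebra_simps)
    also have "\<dots> \<le> diameter (U i)" using bdd i diameter_bounded_bound by blast
    finally have le: "\<rho> * R \<le> diameter (U i)" .
    have "\<rho>0 * R \<le> \<rho> * R" using \<rho> R by simp
    then have "(\<rho>0 * R) powr s \<le> diameter (U i) powr s"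
      using le s \<rho>0 R by (intro powr_mono2) (linarith | simp)+
    also have "\<dots> \<le> (\<Sum>i\<in>I. diameter (U i) powr s)"
      by (rule member_le_sum) (use i psubset.hyps in auto)
    finally show ?thesis .
  next
    case False
    define J where "J t = {i\<in>I. U i \<inter> cball t (\<rho>*R) \<noteq> {}}" for t
    have "1 < card T"
    proof (rule ccontr)
      assume "\<not> 1 < card T"
      then have "real (card T) * \<rho> powr s \<le> 1 * \<rho> powr s" by (intro mult_right_mono) auto
      also have "\<rho> powr s < 1 powr s" using \<rho> \<rho>pos s by (intro powr_less_mono2) auto
      finally show False using cT by simp
    qed
    have nonempty: "J t \<noteq> {}" if "t \<in> T" for t
    proof -
      have "t \<in> A" using good gT that by blast
      have "t \<in> cball t (\<rho>*R)" using \<rho>pos R by auto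
      then have "t \<in> cball x R" using sub[OF that] by (rule rev_subsetD)
      with \<open>t \<in> A\<close> have "t \<in> (\<Union>i\<in>I. U i)" using psubset.prems(2) by (meson IntI subsetD)
      then obtain i where "i \<in> I" "t \<in> U i" by (rule UN_E)
      with \<open>t \<in> cball t (\<rho>*R)\<close> have "i \<in> J t" unfolding J_def by blast
      then show ?thesis by auto
    qed
    have disj: "J t \<inter> J t' = {}" if "t \<in> T" "t' \<in> T" "t \<noteq> t'" for t t'
    proof (rule ccontr)
      assume "J t \<inter> J t' \<noteq> {}"
      then obtain i where "i \<in> I" "U i \<inter> cball t (\<rho>*R) \<noteq> {}" "U i \<inter> cball t' (\<rho>*R) \<noteq> {}"
        unfolding J_def by auto
      then show False using False that by (meson bexI)
    qed
    have step: "(\<rho>0 * (\<rho> * R)) powr s \<le> (\<Sum>i\<in>J t. diameter (U i) powr s)" if t: "t \<in> T" for t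
    proof (rule psubset.IH)
      obtain t' where "t' \<in> T" "t' \<noteq> t"
      proof -
        have "\<not> T \<subseteq> {t}" using \<open>1 < card T\<close> card_mono[of "{t}" T] by auto
        then show ?thesis using that by blast
      qed
      then show "J t \<subset> I" using nonempty[of t'] disj[of t t'] t unfolding J_def by blast
      show "good t (\<rho> * R)" using gT t .
      show "A \<inter> cball t (\<rho> * R) \<subseteq> (\<Union>i\<in>J t. U i)"
        using psubset.prems(2) sub[OF t] unfolding J_def by blast
      show "bounded (U i)" if "i \<in> J t" for i using bdd that unfolding J_def by blast
    qed
    have "(\<rho>0 * R) powr s \<le> (real (card T) * \<rho> powr s) * (\<rho>0 * R) powr s"
      using cT by (intro mult_le_cancel_right1[THEN iffD2]) auto
    also have "\<dots> = (\<Sum>t\<in>T. (\<rho>0 * (\<rho> * R)) powr s)"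
      using \<rho>0 \<rho>pos R by (simp add: powr_mult)
    also have "\<dots> \<le> (\<Sum>t\<in>T. \<Sum>i\<in>J t. diameter (U i) powr s)" by (intro sum_mono step)
    also have "\<dots> = (\<Sum>i\<in>(\<Union>t\<in>T. J t). diameter (U i) powr s)"
      using fT psubset.hyps disj by (intro sum.UNION_disjoint[symmetric]) (auto simp: J_def)
    also have "\<dots> \<le> (\<Sum>i\<in>I. diameter (U i) powr s)"
      using psubset.hyps by (intro sum_mono2) (auto simp: J_def)
    finally show ?thesis .
  qed
qed

lemma open_superset_diameter_powr:
  fixes U :: "'a::real_normed_vector set"
  assumes "bounded U" "0 < s" "0 < e"
  obtains V where "open V" "bounded V" "U \<subseteq> V" "diameter V powr s \<le> diameter U powr s + e"
proof -
  have "((\<lambda>h. (diameter U + 2 * h) powr s) \<longlongrightarrow> (diameter U + 2 * 0) powr s) (at_right 0)"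
    using assms diameter_ge_0[OF assms(1)]
    by (intro tendsto_powr2 tendsto_intros) (auto simp: eventually_at_filter)
  then have "\<forall>\<^sub>F h in at_right 0. (diameter U + 2 * h) powr s < diameter U powr s + e"
    by (rule order_tendstoD(2)) (use assms in simp)
  then have "\<forall>\<^sub>F h in at_right 0. 0 < h \<and> (diameter U + 2 * h) powr s < diameter U powr s + e"
    by (simp add: eventually_conj_iff eventually_at_right_less)
  then obtain h where h: "0 < h" "(diameter U + 2 * h) powr s < diameter U powr s + e"
    using eventually_happens'[OF trivial_limit_at_right_real] by blast
  define V where "V = (\<Union>u\<in>U. ball u h)"
  have d: "dist x y \<le> diameter U + 2 * h" if "x \<in> V" "y \<in> V" for x y
  proof -
    obtain u v where u: "u \<in> U" "dist u x < h" "v \<in> U" "dist v y < h" using \<open>x\<in>V\<close> \<open>y\<in>V\<close> by (auto simp: V_def)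
    have "dist u v \<le> diameter U" using u assms diameter_bounded_bound by blast
    then show ?thesis using u by metric
  qed
  show thesis
  proof
    show "open V" "U \<subseteq> V" using h by (auto simp: V_def)
    show "bounded V" using d by (auto simp: bounded_two_points)
    have "diameter V \<le> diameter U + 2 * h"
      using d h diameter_ge_0[OF assms(1)] by (intro diameter_le) (auto simp: dist_norm)
    then have "diameter V powr s \<le> (diameter U + 2 * h) powr s"
      using assms diameter_ge_0[OF \<open>bounded V\<close>] by (intro powr_mono2) auto
    then show "diameter V powr s \<le> diameter U powr s + e" using h by simp
  qed
qed

text \<open>Countable covers are reduced to finite ones by compactness, after enlarging the \<open>i\<close>-th set to an
  open set at a cost of at most \<open>e / 2\<^bsup>i+1\<^esup>\<close>.\<close>

lemma hausdorff_measure_pos_if_finite_covers: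
  fixes E :: "'a::real_normed_vector set"
  assumes "compact E" "0 < s" "0 < c"
    and fin: "\<And>(U :: nat \<Rightarrow> 'a set) I. \<lbrakk>finite I; E \<subseteq> (\<Union>i\<in>I. U i); \<And>i. bounded (U i)\<rbrakk>
      \<Longrightarrow> c \<le> (\<Sum>i\<in>I. diameter (U i) powr s)"
  shows "hausdorff_measure s E \<noteq> 0"
proof -
  have key: "ennreal c \<le> (\<Sum>i. diam_powr s (U i))"
    if U: "E \<subseteq> (\<Union>i. U i)" "\<And>i. bounded (U i)" for U :: "nat \<Rightarrow> 'a set"
  proof (rule ennreal_le_epsilon)
    fix e :: real assume "0 < e"
    have "\<exists>V. open V \<and> bounded V \<and> U i \<subseteq> V \<and>
        diameter V powr s \<le> diameter (U i) powr s + e * (1/2)^(Suc i)" for i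
      using open_superset_diameter_powr[of "U i" s "e * (1/2)^(Suc i)"] U \<open>0 < e\<close> \<open>0 < s\<close>
      by (metis half_gt_zero_iff mult_pos_pos zero_less_one zero_less_power)
    then obtain V where V: "\<And>i. open (V i)" "\<And>i. bounded (V i)" "\<And>i. U i \<subseteq> V i"
      "\<And>i. diameter (V i) powr s \<le> diameter (U i) powr s + e * (1/2)^(Suc i)" by metis
    have "E \<subseteq> (\<Union>i. V i)" using U V(3) by blast
    then obtain I where I: "finite I" "E \<subseteq> (\<Union>i\<in>I. V i)"
      using compactE_image[OF \<open>compact E\<close>, of UNIV V] V(1) by auto
    have "c \<le> (\<Sum>i\<in>I. diameter (V i) powr s)" using fin I V(2) by blast
    also have "\<dots> \<le> (\<Sum>i\<in>I. diameter (U i) powr s + e * (1/2)^(Suc i))" by (intro sum_mono V)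
    also have "\<dots> = (\<Sum>i\<in>I. diameter (U i) powr s) + e * (\<Sum>i\<in>I. (1/2)^(Suc i))"
      by (simp add: sum.distrib sum_distrib_left)
    also have "(\<Sum>i\<in>I. (1/2)^(Suc i)) \<le> (1::real)"
      using sum_le_suminf[of "\<lambda>i. (1/2::real)^(Suc i)" I] power_half_series I(1)
      by (auto simp: sums_iff)
    finally have "c \<le> (\<Sum>i\<in>I. diameter (U i) powr s) + e" using \<open>0 < e\<close> by simp
    then have "ennreal c \<le> ennreal (\<Sum>i\<in>I. diameter (U i) powr s) + ennreal e"
      by (metis \<open>0 < e\<close> ennreal_leI ennreal_plus less_eq_real_def powr_ge_zero sum_nonneg)
    also have "ennreal (\<Sum>i\<in>I. diameter (U i) powr s) = (\<Sum>i\<in>I. ennreal (diameter (U i) powr s))"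
      by (simp add: sum_ennreal)
    also have "\<dots> = (\<Sum>i\<in>I. diam_powr s (U i))"
      using \<open>0 < s\<close> by (intro sum.cong) (auto simp: diam_powr_def)
    also have "\<dots> \<le> (\<Sum>i. diam_powr s (U i))" by (intro sum_le_suminf I) auto
    finally show "ennreal c \<le> (\<Sum>i. diam_powr s (U i)) + ennreal e" by (simp add: add_mono)
  qed
  have "ennreal c \<le> hausdorff_premeasure s 1 E"
    unfolding hausdorff_premeasure_def by (rule INF_greatest) (use key in auto)
  also have "\<dots> \<le> hausdorff_measure s E"
    unfolding hausdorff_measure_def by (rule SUP_upper) simp
  finally have "ennreal c \<le> hausdorff_measure s E" .
  moreover have "0 < ennreal c" using \<open>0 < c\<close> by simp
  ultimately show ?thesis by (metis leD)
qed

text \<open>The exponent \<open>0\<close> is separate because of the convention \<open>|U|\<^sup>0 = 1\<close>: singletons count, whereas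
  their diameter raised to the power \<open>0\<close> by \<open>powr\<close> would vanish.\<close>

lemma hausdorff_measure_0_nonzero:
  fixes E :: "'a::metric_space set"
  assumes "E \<noteq> {}"
  shows "hausdorff_measure 0 E \<noteq> 0"
proof -
  have "1 \<le> (\<Sum>i. diam_powr 0 (U i))" if U: "E \<subseteq> (\<Union>i. U i)" for U :: "nat \<Rightarrow> 'a set"
  proof -
    obtain x where "x \<in> E" using assms by blast
    then have "x \<in> (\<Union>i. U i)" using U by (rule rev_subsetD)
    then obtain i where "x \<in> U i" by (rule UN_E)
    then have "U i \<noteq> {}" by blast
    then have "1 = (\<Sum>i\<in>{i}. diam_powr 0 (U i))" by (simp add: diam_powr_def)
    also have "\<dots> \<le> (\<Sum>i. diam_powr 0 (U i))" by (intro sum_le_suminf) auto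
    finally show ?thesis .
  qed
  then have "1 \<le> hausdorff_premeasure 0 1 E"
    unfolding hausdorff_premeasure_def by (intro INF_greatest) auto
  also have "\<dots> \<le> hausdorff_measure 0 E"
    unfolding hausdorff_measure_def by (rule SUP_upper) simp
  finally have "1 \<le> hausdorff_measure 0 E" .
  then show ?thesis by (metis leD zero_less_one)
qed

section \<open>Hausdorff dimension and upper box dimension\<close>

lemma hausdorff_premeasure_le_card_mult:
  fixes U :: "'b \<Rightarrow> 'a::metric_space set"
  assumes "finite P" "E \<subseteq> (\<Union>a\<in>P. U a)" "0 < s"
    and U: "\<And>a. a \<in> P \<Longrightarrow> bounded (U a)" "\<And>a. a \<in> P \<Longrightarrow> diameter (U a) \<le> b" and "0 \<le> b" "b \<le> \<delta>"
  shows "hausdorff_premeasure s \<delta> E \<le> ennreal (real (card P) * b powr s)"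
proof -
  obtain f where f: "bij_betw f {..<card P} P"
    using ex_bij_betw_nat_finite[OF \<open>finite P\<close>] by (auto simp: atLeast0LessThan)
  define V where "V i = (if i < card P then U (f i) else {})" for i
  have fP: "f i \<in> P" if "i < card P" for i using f that by (auto simp: bij_betw_def)
  have "E \<subseteq> (\<Union>i. V i)"
  proof
    fix x assume "x \<in> E"
    then obtain a where "a \<in> P" "x \<in> U a" using assms by blast
    then obtain i where "i < card P" "a = f i" using f by (auto simp: bij_betw_def)
    then show "x \<in> (\<Union>i. V i)" using \<open>x \<in> U a\<close> by (auto simp: V_def)
  qed
  moreover have "bounded (V i) \<and> diameter (V i) \<le> \<delta>" for i
    using U fP \<open>0 \<le> b\<close> \<open>b \<le> \<delta>\<close> by (auto simp: V_def intro: order_trans)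
  ultimately have "hausdorff_premeasure s \<delta> E \<le> (\<Sum>i. diam_powr s (V i))"
    unfolding hausdorff_premeasure_def by (intro INF_lower) auto
  also have "\<dots> = (\<Sum>i<card P. diam_powr s (V i))"
    by (rule suminf_finite) (auto simp: V_def diam_powr_def)
  also have "\<dots> \<le> (\<Sum>i<card P. ennreal (b powr s))"
  proof (rule sum_mono)
    fix i assume "i \<in> {..<card P}"
    then have "diameter (U (f i)) powr s \<le> b powr s"
      using U fP \<open>0 < s\<close> diameter_ge_0 by (intro powr_mono2) auto
    then show "diam_powr s (V i) \<le> ennreal (b powr s)"
      using \<open>0 < s\<close> by (auto simp: diam_powr_def V_def intro: ennreal_leI)
  qed
  also have "\<dots> = ennreal (real (card P) * b powr s)"
    by (simp add: ennreal_mult ennreal_of_nat_eq_real_of_nat)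
  finally show ?thesis .
qed

lemma upper_box_dim_nonneg:
  fixes E :: "'a::euclidean_space set"
  assumes "bounded E" "E \<noteq> {}"
  shows "0 \<le> upper_box_dim E"
  unfolding upper_box_dim_def
proof (rule le_Limsup)
  have nonneg: "0 \<le> ereal (ln (real (covering_number r E)) / - ln r)" if "0 < r" "r < 1" for r
  proof -
    have "1 \<le> covering_number r E" by (intro covering_number_pos assms that)
    then show ?thesis using that by (simp add: divide_nonneg_neg)
  qed
  show "\<forall>\<^sub>F r in at_right 0. 0 \<le> ereal (ln (real (covering_number r E)) / - ln r)"
    by (rule eventually_at_rightI[of 0 1]) (simp_all only: nonneg greaterThanLessThan_iff zero_less_one)
qed simp

lemma hausdorff_dim_le_upper_box_dim:
  fixes E :: "'a::euclidean_space set"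
  assumes "bounded E" "E \<noteq> {}"
  shows "hausdorff_dim E \<le> upper_box_dim E"
proof (rule ccontr)
  assume "\<not> hausdorff_dim E \<le> upper_box_dim E"
  then obtain t where t: "upper_box_dim E < ereal t" "ereal t < hausdorff_dim E"
    using ereal_dense2 by (meson not_le)
  then obtain s where s: "ereal t < ereal s" "ereal s < hausdorff_dim E"
    using ereal_dense2 by blast
  have "0 < t" using le_less_trans[OF upper_box_dim_nonneg[OF assms] t(1)] by simp
  then have "0 < s" "0 < s - t" using s by simp_all
  have ev: "\<forall>\<^sub>F r in at_right 0. ereal (ln (real (covering_number r E)) / - ln r) < ereal t"
    using t(1) unfolding upper_box_dim_def by (rule Limsup_lessD)
  let ?d = "real DIM('a)"
  \<comment> \<open>Fewer than \<open>r powr - t\<close> cubes of diameter at most \<open>r DIM\<close> give a sum of order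
    \<open>r powr (s - t)\<close>, which tends to \<open>0\<close>.\<close>
  have "hausdorff_premeasure s \<delta> E \<le> 0" if "0 < \<delta>" for \<delta>
  proof (rule ennreal_le_epsilon)
    fix e :: real assume "0 < e"
    have "((\<lambda>r. ?d powr s * r powr (s - t)) \<longlongrightarrow> ?d powr s * 0 powr (s - t)) (at_right 0)"
      using \<open>0 < s - t\<close> by (intro tendsto_intros tendsto_powr2) (auto simp: eventually_at_filter)
    then have "\<forall>\<^sub>F r in at_right 0. ?d powr s * r powr (s - t) < e"
      by (rule order_tendstoD(2)) (use \<open>0 < e\<close> in simp)
    moreover have "\<forall>\<^sub>F r in at_right 0. 0 < r \<and> r < min 1 (\<delta> / ?d)"
      using \<open>0 < \<delta>\<close> by (intro eventually_at_rightI[of 0 "min 1 (\<delta> / ?d)"]) auto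
    ultimately have "\<forall>\<^sub>F r in at_right 0. ?d powr s * r powr (s - t) < e \<and>
        (0 < r \<and> r < min 1 (\<delta> / ?d)) \<and> ln (real (covering_number r E)) / - ln r < t"
      using ev by eventually_elim auto
    then obtain r where r: "?d powr s * r powr (s - t) < e" "0 < r" "r < 1" "r < \<delta> / ?d"
      "ln (real (covering_number r E)) / - ln r < t"
      using eventually_happens'[OF trivial_limit_at_right_real] by auto
    obtain P where P: "finite P" "card P = covering_number r E" "E \<subseteq> (\<Union>a\<in>P. cbox a (a + r *\<^sub>R One))"
      using covering_number_attained[OF assms(1) \<open>0 < r\<close>] by blast
    have "1 \<le> card P" using covering_number_pos[OF assms(1) \<open>0 < r\<close> assms(2)] P by simp
    have "0 < - ln r" using r by simp
    then have "ln (real (card P)) < t * - ln r"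
      using r(5) P(2) by (metis pos_divide_less_eq)
    then have "ln (real (card P)) < ln (r powr - t)" using r by (simp add: ln_powr)
    then have "real (card P) < r powr - t" using \<open>1 \<le> card P\<close> r by (subst (asm) ln_less_cancel_iff) auto
    then have "real (card P) * (r * ?d) powr s \<le> r powr - t * (r * ?d) powr s"
      by (intro mult_right_mono) auto
    also have "\<dots> = ?d powr s * r powr (s - t)"
      using r by (simp add: powr_mult powr_diff powr_minus divide_simps)
    also have "\<dots> \<le> e" using r by simp
    finally have *: "real (card P) * (r * ?d) powr s \<le> e" .
    have "hausdorff_premeasure s \<delta> E \<le> ennreal (real (card P) * (r * ?d) powr s)"
      using P diameter_cube_le[of r] r \<open>0 < s\<close>
      by (intro hausdorff_premeasure_le_card_mult) (auto simp: field_simps)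
    also have "\<dots> \<le> ennreal e" using * by (rule ennreal_leI)
    finally show "hausdorff_premeasure s \<delta> E \<le> 0 + ennreal e" by simp
  qed
  then have "hausdorff_measure s E = 0" unfolding hausdorff_measure_def by (simp add: SUP_eq_const)
  then have "hausdorff_dim E \<le> ereal s" unfolding hausdorff_dim_def
    using \<open>0 < s\<close> by (intro INF_lower) auto
  then show False using s by simp
qed

lemma upper_box_dim_le:
  fixes E :: "'a::euclidean_space set"
  assumes "bounded E" "E \<noteq> {}" "0 < K" "0 < r0"
    and N: "\<And>r. \<lbrakk>0 < r; r < r0\<rbrakk> \<Longrightarrow> real (covering_number r E) \<le> (K / r) powr s"
  shows "upper_box_dim E \<le> ereal s"
proof -
  \<comment> \<open>The constant \<open>K\<close> only contributes a term of order \<open>1 / ln r\<close>, which vanishes at \<open>0\<close>.\<close>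
  have le: "ln (real (covering_number r E)) / - ln r \<le> s - s * ln K * inverse (ln r)"
    if "0 < r" "r < min 1 r0" for r
  proof -
    have "1 \<le> covering_number r E" by (intro covering_number_pos assms that)
    then have "ln (real (covering_number r E)) \<le> ln ((K / r) powr s)"
      using N[of r] that \<open>0 < K\<close> by (intro ln_mono) auto
    also have "\<dots> = s * (ln K - ln r)" using that \<open>0 < K\<close> by (simp add: ln_powr ln_div)
    finally have "ln (real (covering_number r E)) / - ln r \<le> s * (ln K - ln r) / - ln r"
      using that by (intro divide_right_mono) auto
    also have "\<dots> = s - s * ln K * inverse (ln r)" using that by (simp add: field_simps)
    finally show ?thesis .
  qed
  have "upper_box_dim E \<le> Limsup (at_right 0) (\<lambda>r. ereal (s - s * ln K * inverse (ln r)))"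
    unfolding upper_box_dim_def
    by (rule Limsup_mono, rule eventually_at_rightI[of 0 "min 1 r0"]) (use le assms in auto)
  also have "\<dots> = ereal s"
  proof (rule lim_imp_Limsup)
    have "filterlim ln at_infinity (at_right (0::real))"
      using ln_at_0 at_bot_le_at_infinity filterlim_mono by blast
    then have "((\<lambda>r::real. inverse (ln r)) \<longlongrightarrow> 0) (at_right 0)"
      by (rule filterlim_compose[OF tendsto_inverse_0])
    then have "((\<lambda>r. s - s * ln K * inverse (ln r)) \<longlongrightarrow> s - s * ln K * 0) (at_right 0)"
      by (intro tendsto_intros)
    then show "((\<lambda>r. ereal (s - s * ln K * inverse (ln r))) \<longlongrightarrow> ereal s) (at_right 0)" by simp
  qed simp
  finally show ?thesis .
qed

section \<open>Hausdorff dimension of gallery members\<close>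

lemma lower_exponent_spaced:
  fixes F :: "'a::euclidean_space set"
  assumes low: "\<And>x R r. \<lbrakk>x \<in> F; 0 < r; r < R; R < 1\<rbrakk> \<Longrightarrow>
      C * (R / r) powr s \<le> real (covering_number r (cball x R \<inter> F))"
    and "x \<in> F" "0 < \<delta>" "2 * \<delta> < R" "R < 1"
  obtains T where "finite T" "T \<subseteq> F \<inter> cball x R" "spaced \<delta> T"
    "C * (R / (2 * \<delta>)) powr s \<le> real (card T)"
proof -
  have "bounded (cball x R \<inter> F)" "0 < 2 * \<delta>" using assms by (auto intro: bounded_subset)
  then obtain T where T: "finite T" "T \<subseteq> cball x R \<inter> F" "spaced (2 * \<delta> / 2) T"
    "covering_number (2 * \<delta>) (cball x R \<inter> F) \<le> card T"
    by (rule covering_number_le_spaced)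
  have "C * (R / (2 * \<delta>)) powr s \<le> real (covering_number (2 * \<delta>) (cball x R \<inter> F))"
    using assms(2-5) by (intro low) auto
  then show thesis using T by (intro that[of T]) (auto simp: Int_commute)
qed

text \<open>Magnification by \<open>c \<ge> 1\<close> preserves the bound together with its constant, since a radius
  \<open>R < 1\<close> in the image comes from the radius \<open>R / c < 1\<close> in \<open>F\<close>. This uniformity is what makes
  the bound survive limits of minisets.\<close>

lemma lower_exponent_spaced_affine:
  fixes F :: "'a::euclidean_space set"
  assumes low: "\<And>x R r. \<lbrakk>x \<in> F; 0 < r; r < R; R < 1\<rbrakk> \<Longrightarrow>
      C * (R / r) powr s \<le> real (covering_number r (cball x R \<inter> F))"
    and "1 \<le> c" and x: "x \<in> (\<lambda>y. c *\<^sub>R y + t) ` F" and "0 < \<delta>" "2 * \<delta> < R" "R < 1"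
  obtains T where "finite T" "T \<subseteq> (\<lambda>y. c *\<^sub>R y + t) ` F \<inter> cball x R" "spaced \<delta> T"
    "C * (R / (2 * \<delta>)) powr s \<le> real (card T)"
proof -
  obtain y where y: "y \<in> F" "x = c *\<^sub>R y + t" using x by auto
  have "R / c \<le> R / 1" using \<open>1 \<le> c\<close> \<open>0 < \<delta>\<close> \<open>2 * \<delta> < R\<close> by (intro divide_left_mono) auto
  then have "R / c < 1" using \<open>R < 1\<close> by simp
  have "0 < \<delta> / c" "2 * (\<delta> / c) < R / c"
    using assms(2,4,5) by (auto simp: field_simps)
  from lower_exponent_spaced[of F C s, OF low y(1) this \<open>R / c < 1\<close>]
  obtain T where T: "finite T" "T \<subseteq> F \<inter> cball y (R / c)" "spaced (\<delta> / c) T"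
    "C * (R / c / (2 * (\<delta> / c))) powr s \<le> real (card T)" by blast
  have "0 < c" using \<open>1 \<le> c\<close> by simp
  define T' where "T' = (\<lambda>z. c *\<^sub>R z + t) ` T"
  show thesis
  proof
    show "finite T'" using T by (simp add: T'_def)
    show "T' \<subseteq> (\<lambda>y. c *\<^sub>R y + t) ` F \<inter> cball x R"
    proof
      fix w assume "w \<in> T'"
      then obtain z where z: "z \<in> T" "w = c *\<^sub>R z + t" by (auto simp: T'_def)
      then have "z \<in> F" "dist y z \<le> R / c" using T(2) by auto
      moreover have "dist x w = c * dist y z"
        using \<open>0 < c\<close> by (simp add: y z dist_norm flip: scaleR_diff_right)
      ultimately show "w \<in> (\<lambda>y. c *\<^sub>R y + t) ` F \<inter> cball x R"
        using z \<open>0 < c\<close> by (auto simp: field_simps)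
    qed
    show "spaced \<delta> T'"
      using spaced_affine_image(1)[OF \<open>0 < c\<close> T(3), of t] \<open>0 < c\<close> by (simp add: T'_def)
    show "C * (R / (2 * \<delta>)) powr s \<le> real (card T')"
      using T(4) spaced_affine_image(2)[OF \<open>0 < c\<close> T(3), of t] \<open>0 < c\<close> by (simp add: T'_def)
  qed
qed

text \<open>The bound is inherited by microsets, but only in balls contained in the unit cube: near the
  boundary, a miniset may have lost most of the points of \<open>F\<close> to the intersection with the cube.\<close>

lemma microset_spaced:
  fixes F :: "'a::euclidean_space set"
  assumes low: "\<And>x R r. \<lbrakk>x \<in> F; 0 < r; r < R; R < 1\<rbrakk> \<Longrightarrow>
      C * (R / r) powr s \<le> real (covering_number r (cball x R \<inter> F))"
    and E: "microset F E" and x: "x \<in> E" "cball x R \<subseteq> unit_cube"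
    and \<delta>: "0 < \<delta>" "16 * \<delta> < R" "R < 1"
  obtains T where "finite T" "T \<subseteq> E" "T \<subseteq> cball x (R/2)" "spaced \<delta> T"
    "C * (R / (16 * \<delta>)) powr s \<le> real (card T)"
proof -
  \<comment> \<open>The points are found at spacing \<open>2 \<delta>\<close> in a nearby miniset; moving them by less than
    \<open>\<delta> / 2\<close> into \<open>E\<close> leaves spacing \<open>\<delta>\<close>.\<close>
  define e where "e = \<delta> / 2"
  have "0 < e" using \<delta> by (simp add: e_def)
  obtain D where D: "\<And>n. miniset F (D n)" "(\<lambda>n. hausdorff_dist (D n) E) \<longlonglongrightarrow> 0"
    using E unfolding microset_def by blast
  have "\<forall>\<^sub>F n in sequentially. hausdorff_dist (D n) E < e"
    using D(2) \<open>0 < e\<close> by (rule order_tendstoD(2))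
  then obtain n where n: "hausdorff_dist (D n) E < e" by (auto simp: eventually_sequentially)
  have cD: "compact (D n)" "D n \<noteq> {}" and cE: "compact E" "E \<noteq> {}"
    using D(1)[of n] E by (auto simp: miniset_def microset_def compacts_of_cube_def)
  obtain c t where c: "1 \<le> c" "D n = (\<lambda>x. c *\<^sub>R x + t) ` F \<inter> unit_cube"
    using D(1)[of n] unfolding miniset_def by blast
  have n': "hausdorff_dist E (D n) < e" using n by (simp add: hausdorff_dist_commute)
  obtain x' where x': "x' \<in> D n" "dist x x' < e"
    using hausdorff_dist_less_imp_near[OF cE(1) cD n' x(1)] by blast
  have "x' \<in> (\<lambda>x. c *\<^sub>R x + t) ` F" "0 < 2 * \<delta>" "2 * (2 * \<delta>) < R / 4" "R / 4 < 1"
    using x'(1) c(2) \<delta> by auto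
  \<comment> \<open>Starting from radius \<open>R / 4\<close> keeps the points inside the unit cube, where the miniset and
    the whole affine image of \<open>F\<close> agree.\<close>
  from lower_exponent_spaced_affine[of F C s, OF low c(1) this]
  obtain T where T: "finite T" "T \<subseteq> (\<lambda>y. c *\<^sub>R y + t) ` F \<inter> cball x' (R/4)" "spaced (2 * \<delta>) T"
    "C * (R / 4 / (2 * (2 * \<delta>))) powr s \<le> real (card T)" by blast
  have T_near: "dist x u \<le> e + R/4" if "u \<in> T" for u
  proof -
    have "dist x' u \<le> R/4" using T(2) that by auto
    then show ?thesis using x'(2) dist_triangle[of x u x'] by simp
  qed
  have "T \<subseteq> D n"
  proof
    fix u assume u: "u \<in> T"
    have "dist x u \<le> R" using T_near[OF u] \<delta> by (simp add: e_def)
    then have "u \<in> unit_cube" using x(2) by (meson mem_cball subsetD)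
    then show "u \<in> D n" using T(2) u c(2) by auto
  qed
  have "2 * e < 2 * \<delta>" using \<delta> by (simp add: e_def)
  from spaced_transfer[OF cD(1) cE n T(1) \<open>T \<subseteq> D n\<close> T(3) this]
  obtain T' where T': "finite T'" "T' \<subseteq> E" "card T' = card T" "spaced (2 * \<delta> - 2 * e) T'"
    "\<And>u. u \<in> T' \<Longrightarrow> \<exists>v\<in>T. dist v u < e" by blast
  show thesis
  proof
    show "T' \<subseteq> cball x (R/2)"
    proof
      fix u assume "u \<in> T'"
      then obtain v where "v \<in> T" "dist v u < e" using T'(5) by blast
      then have "dist x u \<le> e + R/4 + e" using T_near[of v] dist_triangle[of x u v] by simp
      then show "u \<in> cball x (R/2)" using \<delta> by (simp add: e_def)
    qed
    show "spaced \<delta> T'" using T'(4) by (simp add: e_def)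
    show "C * (R / (16 * \<delta>)) powr s \<le> real (card T')" using T(4) T'(3) by simp
  qed (use T' in auto)
qed

text \<open>Starting the branching requires one ball centred in \<open>E\<close> and contained in the cube, and the
  condition that \<open>E\<close> meets the open cube provides exactly this.\<close>

lemma lower_dim_le_hausdorff_dim_gallery:
  fixes F :: "'a::euclidean_space set"
  assumes E: "E \<in> gallery F"
  shows "lower_dim F \<le> hausdorff_dim E"
  unfolding lower_dim_def hausdorff_dim_def
proof (rule SUP_least, rule INF_greatest)
  fix s \<sigma> :: real
  assume "s \<in> {s. 0 \<le> s \<and> (\<exists>C>0. \<forall>R. 0 < R \<and> R < 1 \<longrightarrow> (\<forall>r. 0 < r \<and> r < R \<longrightarrow> (\<forall>x\<in>F.
           real (covering_number r (cball x R \<inter> F)) \<ge> C * (R / r) powr s)))}"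
  then obtain C where "0 < C" and low: "\<And>x R r. \<lbrakk>x \<in> F; 0 < r; r < R; R < 1\<rbrakk> \<Longrightarrow>
      C * (R / r) powr s \<le> real (covering_number r (cball x R \<inter> F))"
    by (auto dest: less_trans)
  assume "\<sigma> \<in> {s. 0 \<le> s \<and> hausdorff_measure s E = 0}"
  then have \<sigma>: "0 \<le> \<sigma>" "hausdorff_measure \<sigma> E = 0" by auto
  have mE: "microset F E" and "E \<inter> interior unit_cube \<noteq> {}" using E by (auto simp: gallery_def)
  then have "compact E" by (auto simp: microset_def compacts_of_cube_def)
  have "\<sigma> \<noteq> 0" using hausdorff_measure_0_nonzero[of E] \<sigma>(2) \<open>E \<inter> _ \<noteq> {}\<close> by auto
  with \<sigma> have "0 < \<sigma>" by simp
  show "ereal s \<le> ereal \<sigma>"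
  proof (rule ccontr)
    assume "\<not> ereal s \<le> ereal \<sigma>"
    then have "0 < s - \<sigma>" by simp
    \<comment> \<open>The constant \<open>C\<close> is absorbed in the gap between \<open>\<sigma>\<close> and \<open>s\<close> once \<open>\<rho>\<close> is small. The
      bound \<open>1/48\<close> is what \<open>microset_spaced\<close> requires for the spacing \<open>\<delta> = 3 \<rho> R\<close>.\<close>
    have "((\<lambda>\<rho>::real. \<rho> powr (s - \<sigma>)) \<longlongrightarrow> 0 powr (s - \<sigma>)) (at_right 0)"
      using \<open>0 < s - \<sigma>\<close> by (intro tendsto_intros tendsto_powr2) (auto simp: eventually_at_filter)
    then have "\<forall>\<^sub>F \<rho> in at_right 0. \<rho> powr (s - \<sigma>) < C * 48 powr - s"
      by (rule order_tendstoD(2)) (use \<open>0 < C\<close> in simp)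
    moreover have "\<forall>\<^sub>F \<rho> in at_right (0::real). 0 < \<rho> \<and> \<rho> < 1/48"
      by (rule eventually_at_rightI[of 0 "1/48"]) auto
    ultimately have "\<forall>\<^sub>F \<rho> in at_right 0. \<rho> powr (s - \<sigma>) < C * 48 powr - s \<and> 0 < \<rho> \<and> \<rho> < 1/48"
      by (rule eventually_conj)
    then obtain \<rho> :: real where \<rho>: "\<rho> powr (s - \<sigma>) < C * 48 powr - s" "0 < \<rho>" "\<rho> < 1/48"
      using eventually_happens'[OF trivial_limit_at_right_real] by auto
    have "1 = \<rho> powr (s - \<sigma>) * \<rho> powr (\<sigma> - s)" using \<rho> by (simp flip: powr_add)
    also have "\<dots> \<le> C * 48 powr - s * \<rho> powr (\<sigma> - s)" using \<rho> by (intro mult_right_mono) auto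
    also have "\<dots> = C * (1 / (48 * \<rho>)) powr s * \<rho> powr \<sigma>"
      using \<rho> by (simp add: powr_diff powr_divide powr_mult powr_minus divide_simps)
    finally have \<rho>_mass: "1 \<le> C * (1 / (48 * \<rho>)) powr s * \<rho> powr \<sigma>" .
    define good where "good x R \<longleftrightarrow> x \<in> E \<and> 0 < R \<and> R < 1 \<and> cball x R \<subseteq> unit_cube" for x R
    have branch: "\<exists>\<rho>' T. \<rho> \<le> \<rho>' \<and> \<rho>' \<le> 1/2 \<and> finite T \<and> T \<subseteq> cball x (R/2) \<and>
        spaced (3 * \<rho>' * R) T \<and> 1 \<le> real (card T) * \<rho>' powr \<sigma> \<and> (\<forall>t\<in>T. good t (\<rho>' * R))"
      if g: "good x R" for x R
    proof -
      have x: "x \<in> E" "cball x R \<subseteq> unit_cube" and R: "0 < R" "R < 1" using g by (auto simp: good_def)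
      have "0 < 3 * \<rho> * R" "16 * (3 * \<rho> * R) < R" using \<rho> R by auto
      from microset_spaced[of F C s, OF low mE x this \<open>R < 1\<close>]
      obtain T where T: "finite T" "T \<subseteq> E" "T \<subseteq> cball x (R/2)" "spaced (3 * \<rho> * R) T"
        "C * (R / (16 * (3 * \<rho> * R))) powr s \<le> real (card T)" by blast
      have "R / (16 * (3 * \<rho> * R)) = 1 / (48 * \<rho>)" using R by simp
      then have "C * (1 / (48 * \<rho>)) powr s \<le> real (card T)" using T(5) by simp
      then have "C * (1 / (48 * \<rho>)) powr s * \<rho> powr \<sigma> \<le> real (card T) * \<rho> powr \<sigma>"
        by (intro mult_right_mono) auto
      then have "1 \<le> real (card T) * \<rho> powr \<sigma>" using \<rho>_mass by linarith
      moreover have "good t (\<rho> * R)" if "t \<in> T" for t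
      proof -
        have "t \<in> cball x (R/2)" "t \<in> E" using T that by auto
        have "\<rho> * R \<le> 1/2 * R" using \<rho> R by (intro mult_right_mono) auto
        have "cball t (\<rho> * R) \<subseteq> cball x R"
          using \<open>t \<in> cball x (R/2)\<close> \<rho> R by (intro cball_subset_cball_half) auto
        moreover have "\<rho> * R < 1" using R \<open>\<rho> * R \<le> 1/2 * R\<close> by linarith
        ultimately show ?thesis using \<open>t \<in> E\<close> \<rho> R x(2) unfolding good_def by (meson mult_pos_pos order_trans)
      qed
      ultimately show ?thesis using T \<rho> by (intro exI[of _ \<rho>] exI[of _ T]) auto
    qed
    obtain x where "x \<in> E" "x \<in> interior unit_cube" using \<open>E \<inter> _ \<noteq> {}\<close> by blast
    then obtain e where "0 < e" "cball x e \<subseteq> interior unit_cube"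
      using open_contains_cball_eq[OF open_interior, of unit_cube] by auto
    then have g: "good x (min e (1/2))"
      using interior_subset[of unit_cube] \<open>x \<in> E\<close> subset_cball[of "min e (1/2)" e x]
      unfolding good_def by (auto simp del: interior_cbox)
    have "hausdorff_measure \<sigma> E \<noteq> 0"
    proof (rule hausdorff_measure_pos_if_finite_covers[OF \<open>compact E\<close> \<open>0 < \<sigma>\<close>])
      show "0 < (\<rho> * min e (1/2)) powr \<sigma>" using \<rho> \<open>0 < e\<close> by simp
      fix U :: "nat \<Rightarrow> 'a set" and I
      assume U: "finite I" "E \<subseteq> (\<Union>i\<in>I. U i)" "\<And>i. bounded (U i)"
      show "(\<rho> * min e (1/2)) powr \<sigma> \<le> (\<Sum>i\<in>I. diameter (U i) powr \<sigma>)"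
      proof (rule finite_cover_sum_ge[OF \<open>0 < \<sigma>\<close> \<rho>(2) _ branch U(1) g])
        show "E \<inter> cball x (min e (1/2)) \<subseteq> (\<Union>i\<in>I. U i)" using U(2) by (rule le_infI1)
      qed (use U(3) in \<open>auto simp: good_def\<close>)
    qed
    then show False using \<sigma> by simp
  qed
qed

section \<open>A gallery member of minimal dimension\<close>

text \<open>Failure of the exponent \<open>s\<close> gives more than one bad pair of scales: there is a single ball that
  is sparse at all of the first \<open>m\<close> dyadic scales simultaneously. For if every ball were rich at one of
  these scales, the branching could be iterated without any loss of constants and \<open>s\<close> would be
  a lower exponent.\<close>

lemma sparse_location_if_lower_dim_less:
  fixes F :: "'a::euclidean_space set"
  assumes "0 < s" "lower_dim F < ereal s"
  shows "\<exists>x R. x \<in> F \<and> 0 < R \<and> R < 1 \<and> (\<forall>k T. k \<in> {1..m} \<longrightarrow> finite T \<longrightarrow> T \<subseteq> F \<longrightarrow>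
      T \<subseteq> cball x (R/2) \<longrightarrow> spaced (3 * (1/2)^k * R) T \<longrightarrow> real (card T) * ((1/2)^k) powr s < 1)"
proof (rule ccontr)
  assume none: "\<not> ?thesis"
  have neg: "\<exists>k T. k \<in> {1..m} \<and> finite T \<and> T \<subseteq> F \<and> T \<subseteq> cball x (R/2) \<and>
      spaced (3 * (1/2)^k * R) T \<and> 1 \<le> real (card T) * ((1/2)^k) powr s"
    if "x \<in> F" "0 < R" "R < 1" for x R
    using none that by (meson not_le)
  \<comment> \<open>Now every ball branches at one of finitely many ratios, so covers of \<open>F \<inter> cball x R\<close> by
    cubes are as expensive as a lower exponent \<open>s\<close> demands.\<close>
  define good where "good x R \<longleftrightarrow> x \<in> F \<and> 0 < R \<and> R < 1" for x :: 'a and R :: real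
  define \<rho>0 :: real where "\<rho>0 = (1/2)^m"
  have "0 < \<rho>0" by (simp add: \<rho>0_def)
  have branch: "\<exists>\<rho> T. \<rho>0 \<le> \<rho> \<and> \<rho> \<le> 1/2 \<and> finite T \<and> T \<subseteq> cball x (R/2) \<and>
      spaced (3 * \<rho> * R) T \<and> 1 \<le> real (card T) * \<rho> powr s \<and> (\<forall>t\<in>T. good t (\<rho> * R))"
    if "good x R" for x R
  proof -
    have x: "x \<in> F" "0 < R" "R < 1" using that by (auto simp: good_def)
    obtain k T where k: "k \<in> {1..m}" and T: "finite T" "T \<subseteq> F" "T \<subseteq> cball x (R/2)"
      "spaced (3 * (1/2)^k * R) T" "1 \<le> real (card T) * ((1/2)^k) powr s"
      using neg[OF x] by blast
    have "\<rho>0 \<le> (1/2)^k" unfolding \<rho>0_def using k by (intro power_decreasing) auto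
    have half: "(1/2::real)^k \<le> 1/2" using k power_decreasing[of 1 k "1/2::real"] by simp
    have "(1/2)^k * R \<le> 1 * R" using half x by (intro mult_right_mono) auto
    then have "(1/2)^k * R < 1" using x by linarith
    then have "good t ((1/2)^k * R)" if "t \<in> T" for t
      using that T x by (auto simp: good_def)
    then show ?thesis using \<open>\<rho>0 \<le> _\<close> half T by (intro exI[of _ "(1/2)^k"] exI[of _ T]) auto
  qed
  let ?d = "real DIM('a)"
  have "(\<rho>0 / ?d) powr s * (R / r) powr s \<le> real (covering_number r (cball x R \<inter> F))"
    if x: "x \<in> F" "0 < r" "r < R" "R < 1" for x R r
  proof -
    have "good x R" using x by (simp add: good_def)
    have "bounded (cball x R \<inter> F)" by (auto intro: bounded_subset)
    then obtain P where P: "finite P" "card P = covering_number r (cball x R \<inter> F)"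
      "cball x R \<inter> F \<subseteq> (\<Union>a\<in>P. cbox a (a + r *\<^sub>R One))"
      using covering_number_attained[OF _ \<open>0 < r\<close>] by blast
    have "(\<rho>0 * R) powr s \<le> (\<Sum>a\<in>P. diameter (cbox a (a + r *\<^sub>R One)) powr s)"
    proof (rule finite_cover_sum_ge[OF \<open>0 < s\<close> \<open>0 < \<rho>0\<close> _ branch P(1) \<open>good x R\<close>])
      show "F \<inter> cball x R \<subseteq> (\<Union>a\<in>P. cbox a (a + r *\<^sub>R One))" using P(3) by (simp add: Int_commute)
    qed (auto simp: good_def)
    also have "\<dots> \<le> (\<Sum>a\<in>P. (r * ?d) powr s)"
      using \<open>0 < s\<close> \<open>0 < r\<close> diameter_cube_le[of r] diameter_ge_0[OF bounded_cbox]
      by (intro sum_mono powr_mono2) auto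
    also have "\<dots> = real (card P) * (r * ?d) powr s" by simp
    finally have "(\<rho>0 * R) powr s / (r * ?d) powr s \<le> real (card P)"
      using \<open>0 < r\<close> by (simp add: pos_divide_le_eq)
    moreover have "(\<rho>0 / ?d) powr s * (R / r) powr s = (\<rho>0 * R) powr s / (r * ?d) powr s"
      using x \<open>0 < \<rho>0\<close> by (simp add: powr_mult powr_divide)
    ultimately show ?thesis using P(2) by simp
  qed
  moreover have "0 < (\<rho>0 / ?d) powr s" using \<open>0 < \<rho>0\<close> by simp
  ultimately have "s \<in> {s::real. 0 \<le> s \<and>
        (\<exists>C>0. \<forall>R. 0 < R \<and> R < 1 \<longrightarrow> (\<forall>r. 0 < r \<and> r < R \<longrightarrow> (\<forall>x\<in>F.
           real (covering_number r (cball x R \<inter> F)) \<ge> C * (R / r) powr s)))}"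
    using \<open>0 < s\<close> by (intro CollectI conjI exI[of _ "(\<rho>0 / ?d) powr s"]) auto
  then have "ereal s \<le> lower_dim F" unfolding lower_dim_def by (rule SUP_upper)
  then show False using assms by simp
qed

definition cube_centre :: "'a::euclidean_space" where
  "cube_centre = (1/2) *\<^sub>R One"

lemma cube_centre_in_interior: "cube_centre \<in> interior unit_cube"
  by (simp add: cube_centre_def unit_cube_def mem_box)

text \<open>The radius \<open>DIM / 2\<close> comes from comparing the Euclidean norm with the \<open>l\<^sup>1\<close> norm.\<close>

lemma unit_cube_subset_cball: "unit_cube \<subseteq> cball (cube_centre :: 'a::euclidean_space) (DIM('a) / 2)"
proof
  fix y :: 'a assume y: "y \<in> unit_cube"
  have "dist cube_centre y = norm (y - cube_centre)" by (simp add: dist_norm norm_minus_commute)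
  also have "\<dots> \<le> (\<Sum>b\<in>Basis. \<bar>(y - cube_centre) \<bullet> b\<bar>)" by (rule norm_le_l1)
  also have "\<dots> \<le> (\<Sum>b\<in>(Basis::'a set). 1/2)"
  proof (rule sum_mono)
    fix b :: 'a assume b: "b \<in> Basis"
    then have "0 \<le> y \<bullet> b" "y \<bullet> b \<le> 1" using y by (auto simp: unit_cube_def mem_box)
    moreover have "(y - cube_centre) \<bullet> b = y \<bullet> b - 1/2"
      using b by (simp add: cube_centre_def inner_diff_left)
    ultimately show "\<bar>(y - cube_centre) \<bullet> b\<bar> \<le> 1/2" by linarith
  qed
  finally show "y \<in> cball cube_centre (DIM('a) / 2)" by simp
qed

text \<open>The miniset of \<open>F\<close> with magnification \<open>c\<close> in which \<open>x\<close> is moved to the centre of the cube, which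
  guarantees that limits of such minisets still meet the open cube.\<close>

definition zoom :: "'a::euclidean_space set \<Rightarrow> real \<Rightarrow> 'a \<Rightarrow> 'a set" where
  "zoom F c x = (\<lambda>y. c *\<^sub>R y + (cube_centre - c *\<^sub>R x)) ` F \<inter> unit_cube"

lemma zoom_miniset:
  assumes "compact F" "x \<in> F" "1 \<le> c"
  shows "miniset F (zoom F c x)" "cube_centre \<in> zoom F c x"
proof -
  show c: "cube_centre \<in> zoom F c x"
    using assms cube_centre_in_interior interior_subset unfolding zoom_def
    by (auto intro!: image_eqI[of _ _ x])
  have "compact (zoom F c x)"
    unfolding zoom_def unit_cube_def using assms
    by (intro compact_Int compact_cbox compact_continuous_image continuous_intros)
  then show "miniset F (zoom F c x)"
    using c assms(3) unfolding miniset_def compacts_of_cube_def zoom_def by auto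
qed

text \<open>Undoing the magnification by \<open>DIM / R\<close> returns spaced subsets of the miniset to \<open>F\<close>, close
  enough to \<open>x\<close> for \<open>sparse_location_if_lower_dim_less\<close> to bound their cardinality.\<close>

lemma spaced_in_zoom:
  fixes F :: "'a::euclidean_space set" and \<delta> R :: real
  assumes "0 < R" "finite T" "T \<subseteq> zoom F (DIM('a) / R) x" "spaced (\<delta> * real DIM('a)) T"
  obtains T' where "finite T'" "T' \<subseteq> F" "T' \<subseteq> cball x (R/2)" "spaced (\<delta> * R) T'" "card T' = card T"
proof -
  define c where "c = DIM('a) / R"
  have "0 < c" using assms by (simp add: c_def)
  define T' where "T' = (\<lambda>z. (1/c) *\<^sub>R z + (x - (1/c) *\<^sub>R cube_centre)) ` T"
  have "0 < 1/c" using \<open>0 < c\<close> by simp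
  note aff = spaced_affine_image[OF this assms(4)]
  have inF: "\<exists>y\<in>F. z = c *\<^sub>R y + (cube_centre - c *\<^sub>R x) \<and>
      (1/c) *\<^sub>R z + (x - (1/c) *\<^sub>R cube_centre) = y \<and> z \<in> unit_cube" if "z \<in> T" for z
  proof -
    have "z \<in> zoom F c x" using subsetD[OF assms(3) that] by (simp add: c_def)
    then obtain y where "y \<in> F" "z = c *\<^sub>R y + (cube_centre - c *\<^sub>R x)" "z \<in> unit_cube"
      unfolding zoom_def by blast
    moreover from this(2) have "(1/c) *\<^sub>R z + (x - (1/c) *\<^sub>R cube_centre) = y"
      using \<open>0 < c\<close> by (simp add: scaleR_add_right scaleR_diff_right)
    ultimately show ?thesis by blast
  qed
  show thesis
  proof
    show "finite T'" using assms by (simp add: T'_def)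
    show "T' \<subseteq> F" using inF by (force simp: T'_def)
    show "T' \<subseteq> cball x (R/2)"
    proof
      fix w assume "w \<in> T'"
      then obtain z where z: "z \<in> T" "w = (1/c) *\<^sub>R z + (x - (1/c) *\<^sub>R cube_centre)"
        by (auto simp: T'_def)
      then have "dist cube_centre z \<le> DIM('a) / 2"
        using inF[OF z(1)] unit_cube_subset_cball by (meson mem_cball subsetD)
      moreover have "dist x w = (1/c) * dist cube_centre z"
      proof -
        have "x - w = (1/c) *\<^sub>R (cube_centre - z)" by (simp add: z scaleR_diff_right)
        then show ?thesis using \<open>0 < c\<close> by (simp add: dist_norm)
      qed
      ultimately have "dist x w \<le> (1/c) * (DIM('a) / 2)"
        using \<open>0 < 1/c\<close> by (simp only: mult_left_mono less_imp_le)
      also have "\<dots> = R/2" by (simp add: c_def)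
      finally show "w \<in> cball x (R/2)" by simp
    qed
    have "(1/c) * (\<delta> * DIM('a)) = \<delta> * R" by (simp add: c_def)
    then show "spaced (\<delta> * R) T'" using aff(1) unfolding T'_def by metis
    show "card T' = card T" using aff(2) by (simp add: T'_def)
  qed
qed

lemma half_power_between:
  fixes q :: real
  assumes "0 < q" "q \<le> 1/2"
  obtains j where "1 \<le> j" "(1/2)^j \<le> q" "q < 2 * (1/2)^j"
proof -
  obtain n where "(1/2::real)^n < q" using real_arch_pow_inv[of q "1/2"] assms by auto
  then have ex: "\<exists>n. (1/2::real)^n \<le> q" by (auto intro: less_imp_le)
  define j where "j = (LEAST n. (1/2::real)^n \<le> q)"
  have j: "(1/2)^j \<le> q" unfolding j_def by (rule LeastI_ex) (rule ex)
  have "j \<noteq> 0"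
  proof
    assume "j = 0"
    then show False using j assms by simp
  qed
  then have "\<not> (1/2)^(j - 1) \<le> q" unfolding j_def by (intro not_less_Least) simp
  moreover have "(1/2::real)^(j - 1) = 2 * (1/2)^j" using \<open>j \<noteq> 0\<close> by (cases j) auto
  ultimately show thesis using that[of j] j \<open>j \<noteq> 0\<close> by simp
qed

lemma lower_dim_nonneg:
  fixes F :: "'a::euclidean_space set"
  shows "0 \<le> lower_dim F"
proof -
  have "\<forall>R. 0 < R \<and> R < 1 \<longrightarrow> (\<forall>r. 0 < r \<and> r < R \<longrightarrow> (\<forall>x\<in>F.
           real (covering_number r (cball x R \<inter> F)) \<ge> 1 * (R / r) powr 0))"
  proof (intro allI impI ballI)
    fix R r :: real and x assume "0 < R \<and> R < 1" "0 < r \<and> r < R" "x \<in> F"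
    then have "x \<in> cball x R \<inter> F" by simp
    then have "cball x R \<inter> F \<noteq> {}" by blast
    then have "1 \<le> covering_number r (cball x R \<inter> F)"
      using \<open>0 < r \<and> r < R\<close> by (intro covering_number_pos) (auto intro: bounded_subset)
    then show "real (covering_number r (cball x R \<inter> F)) \<ge> 1 * (R / r) powr 0" by simp
  qed
  then have "ereal 0 \<le> lower_dim F"
    unfolding lower_dim_def by (intro SUP_upper) (auto intro!: exI[of _ 1])
  then show ?thesis by (simp add: zero_ereal_def)
qed

text \<open>A limit of minisets magnifying balls sparse at more and more scales is a microset sparse at
  all scales. The case of infinite lower dimension is treated apart because any member of the
  gallery will do there.\<close>

lemma gallery_upper_box_dim_le_lower_dim:
  fixes F :: "'a::euclidean_space set"
  assumes "compact F" "F \<noteq> {}"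
  obtains E where "E \<in> gallery F" "upper_box_dim E \<le> lower_dim F"
proof (cases "lower_dim F = \<infinity>")
  case True
  obtain x where "x \<in> F" using assms by blast
  note z = zoom_miniset[OF assms(1) this order_refl]
  have "compact (zoom F 1 x)" "zoom F 1 x \<noteq> {}"
    using z(1) by (auto simp: miniset_def compacts_of_cube_def)
  then have "hausdorff_dist (zoom F 1 x) (zoom F 1 x) = 0"
    by (intro antisym hausdorff_dist_le hausdorff_dist_nonneg) auto
  then have "microset F (zoom F 1 x)"
    using z(1) unfolding microset_def
    by (intro conjI exI[of _ "\<lambda>_. zoom F 1 x"]) (auto simp: miniset_def)
  then have "zoom F 1 x \<in> gallery F"
    using z(2) cube_centre_in_interior unfolding gallery_def by blast
  then show thesis using that True by simp
next
  case False
  then obtain s where s: "lower_dim F = ereal s" "0 \<le> s"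
    using lower_dim_nonneg[of F] by (cases "lower_dim F") auto
  let ?d = "real DIM('a)"
  \<comment> \<open>Diagonal choice: exponents decreasing to \<open>s\<close>, sparse at the first \<open>n\<close> dyadic scales.\<close>
  define \<sigma> where "\<sigma> n = s + 1 / (real n + 1)" for n :: nat
  have \<sigma>_pos: "0 < \<sigma> n" "s < \<sigma> n" for n using s by (auto simp: \<sigma>_def add_nonneg_pos)
  define sparse where "sparse n x R \<longleftrightarrow> x \<in> F \<and> 0 < R \<and> R < 1 \<and> (\<forall>k T. k \<in> {1..n} \<longrightarrow> finite T \<longrightarrow>
      T \<subseteq> F \<longrightarrow> T \<subseteq> cball x (R/2) \<longrightarrow> spaced (3 * (1/2)^k * R) T \<longrightarrow>
      real (card T) * ((1/2)^k) powr \<sigma> n < 1)" for n x R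
  have "\<exists>x R. sparse n x R" for n
  proof -
    have "lower_dim F < ereal (\<sigma> n)" using s \<sigma>_pos by simp
    then show ?thesis
      unfolding sparse_def by (rule sparse_location_if_lower_dim_less[OF \<sigma>_pos(1)])
  qed
  then obtain x R where sparse: "\<And>n. sparse n (x n) (R n)" by metis
  then have x: "\<And>n. x n \<in> F" and R: "\<And>n. 0 < R n" "\<And>n. R n < 1" by (simp_all add: sparse_def)
  \<comment> \<open>The factor \<open>DIM / R\<close> shrinks the preimage of the unit cube into \<open>cball x (R/2)\<close>, the part
    of \<open>F\<close> whose sparseness is known; it is at least \<open>1\<close>, so the results are minisets.\<close>
  define D where "D n = zoom F (?d / R n) (x n)" for n
  have "1 \<le> ?d / R n" for n
  proof -
    have "R n \<le> 1" using R less_imp_le by blast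
    also have "1 \<le> ?d" using DIM_positive[where 'a='a] by linarith
    finally show ?thesis using R by (simp add: pos_le_divide_eq)
  qed
  then have D: "\<And>n. miniset F (D n)" "\<And>n. cube_centre \<in> D n"
    using zoom_miniset assms(1) x unfolding D_def by blast+
  then have cD: "\<And>n. compact (D n)" "\<And>n. D n \<noteq> {}" "\<And>n. D n \<subseteq> unit_cube"
    by (auto simp: miniset_def compacts_of_cube_def)
  have "compact (unit_cube :: 'a set)" by (simp add: unit_cube_def)
  then obtain E k where k: "strict_mono (k :: nat \<Rightarrow> nat)" and E: "compact E" "E \<noteq> {}" "E \<subseteq> unit_cube"
    and lim: "(\<lambda>n. hausdorff_dist (D (k n)) E) \<longlonglongrightarrow> 0"
    by (rule Blaschke_selection[OF _ cD])
  have "microset F E"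
    unfolding microset_def compacts_of_cube_def using E lim D(1)
    by (auto intro!: exI[of _ "\<lambda>n. D (k n)"])
  have "cube_centre \<in> E"
  proof -
    have "infdist cube_centre E \<le> 0"
    proof (rule LIMSEQ_le_const[OF lim])
      show "\<exists>N. \<forall>n\<ge>N. infdist cube_centre E \<le> hausdorff_dist (D (k n)) E"
        using infdist_le_hausdorff_dist cD(1) D(2) by blast
    qed
    then have "infdist cube_centre E = 0" using infdist_nonneg[of cube_centre E] by linarith
    then show ?thesis using in_closed_iff_infdist_zero[of E] E compact_imp_closed by blast
  qed
  then have "E \<in> gallery F"
    using \<open>microset F E\<close> cube_centre_in_interior unfolding gallery_def by blast
  \<comment> \<open>For each fixed dyadic scale the sparseness of \<open>D (k n)\<close> is available for all large \<open>n\<close>, and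
    the limit of the exponents \<open>\<sigma> (k n)\<close> is \<open>s\<close>: the bound holds in \<open>E\<close> with no loss in the exponent.\<close>
  have count: "real (card T) * ((1/2)^j) powr s \<le> 1"
    if "1 \<le> j" and T: "finite T" "T \<subseteq> E" "spaced (4 * (1/2)^j * ?d) T" for j T
  proof (rule LIMSEQ_le_const2)
    have "(\<lambda>n. \<sigma> (k n)) \<longlonglongrightarrow> s"
    proof -
      have "(\<lambda>n. s + inverse (real (Suc n))) \<longlonglongrightarrow> s + 0"
        by (intro tendsto_intros LIMSEQ_inverse_real_of_nat)
      then have "\<sigma> \<longlonglongrightarrow> s" by (simp add: \<sigma>_def[abs_def] inverse_eq_divide add.commute)
      then show ?thesis using LIMSEQ_subseq_LIMSEQ[OF _ k] by (simp add: o_def)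
    qed
    then show "(\<lambda>n. real (card T) * ((1/2)^j) powr \<sigma> (k n)) \<longlonglongrightarrow> real (card T) * ((1/2)^j) powr s"
      by (intro tendsto_intros) auto
    define e where "e = (1/2)^j * ?d / 2"
    have "0 < e" by (simp add: e_def)
    have "\<forall>\<^sub>F n in sequentially. hausdorff_dist (D (k n)) E < e"
      using lim \<open>0 < e\<close> by (rule order_tendstoD(2))
    then obtain N where N: "\<And>n. N \<le> n \<Longrightarrow> hausdorff_dist (D (k n)) E < e"
      by (auto simp: eventually_sequentially)
    have "real (card T) * ((1/2)^j) powr \<sigma> (k n) \<le> 1" if n: "max N j \<le> n" for n
    proof -
      have "hausdorff_dist E (D (k n)) < e" using N[of n] n by (simp add: hausdorff_dist_commute)
      moreover have "2 * e < 4 * (1/2)^j * ?d" by (simp add: e_def)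
      ultimately obtain T' where T': "finite T'" "T' \<subseteq> D (k n)" "card T' = card T"
        "spaced (4 * (1/2)^j * ?d - 2 * e) T'"
        using spaced_transfer[OF E(1) cD(1,2) _ T] by metis
      have "4 * (1/2)^j * ?d - 2 * e = (3 * (1/2)^j) * ?d" by (simp add: e_def)
      with T'(4) have sp: "spaced ((3 * (1/2)^j) * ?d) T'" by simp
      obtain T'' where T'': "finite T''" "T'' \<subseteq> F" "T'' \<subseteq> cball (x (k n)) (R (k n) / 2)"
        "spaced (3 * (1/2)^j * R (k n)) T''" "card T'' = card T'"
        using spaced_in_zoom[OF R(1) T'(1) T'(2)[unfolded D_def] sp] by metis
      have "j \<in> {1..k n}" using \<open>1 \<le> j\<close> n seq_suble[OF k, of n] by simp
      then have "real (card T'') * ((1/2)^j) powr \<sigma> (k n) < 1"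
        using sparse[of "k n"] T''(1-4) unfolding sparse_def by blast
      then show ?thesis using T''(5) T'(3) by simp
    qed
    then show "\<exists>N. \<forall>n\<ge>N. real (card T) * ((1/2)^j) powr \<sigma> (k n) \<le> 1" by blast
  qed
  have "bounded E" using E(1) by (rule compact_imp_bounded)
  have "upper_box_dim E \<le> ereal s"
  proof (rule upper_box_dim_le[OF \<open>bounded E\<close> E(2)])
    show "0 < 16 * ?d" "0 < 4 * ?d" by simp_all
    fix r :: real assume r: "0 < r" "r < 4 * ?d"
    \<comment> \<open>The dyadic scale for which spacing \<open>r / 2\<close> implies spacing \<open>4 (1/2)^j DIM\<close>.\<close>
    have "0 < r / (8 * ?d)" "r / (8 * ?d) \<le> 1/2" using r by (auto simp: field_simps)
    then obtain j where j: "1 \<le> j" "(1/2)^j \<le> r / (8 * ?d)" "r / (8 * ?d) < 2 * (1/2)^j"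
      by (rule half_power_between)
    obtain T where T: "finite T" "T \<subseteq> E" "spaced (r/2) T" "covering_number r E \<le> card T"
      using covering_number_le_spaced[OF \<open>bounded E\<close> r(1)] by blast
    have "4 * (1/2)^j * ?d \<le> r/2" using j(2) by (simp add: field_simps)
    then have "spaced (4 * (1/2)^j * ?d) T" by (rule spaced_mono[OF T(3)])
    then have "real (card T) * ((1/2)^j) powr s \<le> 1" using count j(1) T(1,2) by blast
    then have "real (card T) \<le> 1 / ((1/2)^j) powr s" by (simp add: pos_le_divide_eq)
    also have "\<dots> = (1 / (1/2)^j) powr s" by (simp add: powr_divide)
    also have "\<dots> \<le> (16 * ?d / r) powr s"
    proof (rule powr_mono2)
      show "1 / (1/2)^j \<le> 16 * ?d / r" using j(3) r by (simp add: field_simps)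
    qed (use s in auto)
    finally show "real (covering_number r E) \<le> (16 * ?d / r) powr s" using T(4) by simp
  qed
  then show thesis using that \<open>E \<in> gallery F\<close> s(1) by simp
qed

theorem theorem1p1:
  fixes F :: "(real ^ 'n) set"
  assumes "compact F" and "F \<noteq> {}"
  shows "(\<exists>E. is_arg_min hausdorff_dim (\<lambda>E. E \<in> gallery F) E \<and> lower_dim F = hausdorff_dim E) \<and>
         (\<exists>E. is_arg_min upper_box_dim (\<lambda>E. E \<in> gallery F) E \<and> lower_dim F = upper_box_dim E)"
proof -
  obtain E where E: "E \<in> gallery F" "upper_box_dim E \<le> lower_dim F"
    using gallery_upper_box_dim_le_lower_dim[OF assms] by blast
  have H: "lower_dim F \<le> hausdorff_dim A" "hausdorff_dim A \<le> upper_box_dim A" if "A \<in> gallery F" for A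
  proof -
    show "lower_dim F \<le> hausdorff_dim A" using that by (rule lower_dim_le_hausdorff_dim_gallery)
    have "compact A" "A \<noteq> {}" using that by (auto simp: gallery_def microset_def compacts_of_cube_def)
    then show "hausdorff_dim A \<le> upper_box_dim A"
      by (intro hausdorff_dim_le_upper_box_dim compact_imp_bounded)
  qed
  have "lower_dim F = hausdorff_dim E" "lower_dim F = upper_box_dim E"
    using H[OF E(1)] E(2) by order+
  moreover have "\<not> hausdorff_dim A < hausdorff_dim E" "\<not> upper_box_dim A < upper_box_dim E"
    if "A \<in> gallery F" for A
    using H[OF that] calculation by order+
  ultimately show ?thesis using E(1) unfolding is_arg_min_def by metis
qed

end
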